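(* Let $\phi=\frac1N\sum_{i=1}^N\phi_i$ and let Assumptions (A1)–(A4) of the context hold. Let $\{\mathbf{x}_k\}$ be the infinite sequence generated by the LSOS algorithm described in the context. If $\phi$ is $\mu$-strongly convex, then $\{\mathbf{x}_k\}$ converges almost surely to the unique solution $\mathbf{x}^*$ of the problem of minimizing $\phi$ over $\mathbb{R}^n$.
   Context: **Problem.** Minimize $\phi(\mathbf{x})=\frac1N\sum_{i=1}^N\phi_i(\mathbf{x})$ over $\mathbf{x}\in\mathbb{R}^n$, where each $\phi_i:\mathbb{R}^n\to\mathbb{R}$ is twice continuously differentiable. Let $\mathcal{N}=\{1,\dots,N\}$. For a nonempty subset $\mathcal{M}\subset\mathcal{N}$ with cardinality $M$, put $f_{\mathcal{M}}(\mathbf{x})=\frac1M\sum_{i\in\mathcal{M}}\phi_i(\mathbf{x})$ and $\mathbf{g}_{\mathcal{M}}(\mathbf{x})=\frac1M\sum_{i\in\mathcal{M}}\nabla\phi_i(\mathbf{x})$. $\|\cdot\|$ is the Euclidean norm. **LSOS algorithm.** Given: $\mathbf{x}_0\in\mathbb{R}^n$, $B_0\in\mathbb{R}^{n\times n}$, $\eta,\beta\in(0,1)$, sequences $\{\alpha_k\},\{\zeta_k\}$ of positive reals and $\{\delta_k\}$ of nonnegative reals, constants $c_{\min}>0$, $C_{\max}>0$, and $K_{\max}\in\mathbb{N}$. Initialize $K_f=0$, $ind=0$, $k=0$. The algorithm is run indefinitely; iteration $k$ is: 1. Choose a sample $\mathcal{N}_k\subset\mathcal{N}$ randomly and uniformly,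 and compute an approximation $\mathbf{g}_k=\mathbf{g}_k(\mathbf{x}_k)$ of $\nabla\phi(\mathbf{x}_k)$ (for instance $\mathbf{g}_{\mathcal{N}_k}(\mathbf{x}_k)$, but other approximations are allowed). 2. Find a direction $\mathbf{d}_k$ such that $\|B_k\mathbf{d}_k+\mathbf{g}_k\|\le\delta_k\|\mathbf{g}_k\|$. 3. If $ind=0$: find the smallest integer $j\ge0$ such that $t_k=\beta^j$ satisfies $$f_{\mathcal{N}_k}(\mathbf{x}_k+t_k\mathbf{d}_k)\le f_{\mathcal{N}_k}(\mathbf{x}_k)+\eta\,t_k\,\mathbf{g}_k^\top\mathbf{d}_k+\zeta_k,$$ and set $\bar{\mathbf{x}}_k=\mathbf{x}_k+t_k\mathbf{d}_k$. Then choose a new sample $\mathcal{D}_k\subset\mathcal{N}$ (of arbitrary size $\ge1$) randomly and uniformly, independently of the past and of $\mathcal{N}_k$. If $$f_{\mathcal{D}_k}(\bar{\mathbf{x}}_k)\le f_{\mathcal{D}_k}(\mathbf{x}_k)-c_{\min}\|\mathbf{g}_{\mathcal{D}_k}(\mathbf{x}_k)\|^2+C_{\max}\zeta_k,$$ set $\mathbf{x}_{k+1}=\bar{\mathbf{x}}_k$; otherwise set $\mathbf{x}_{k+1}=\mathbf{x}_k$, increase $K_f$ by $1$, and if now $K_f>K_{\max}$ set $ind=1$. 4. Otherwise ($ind=1$): set $t_k=\alpha_k$ and $\mathbf{x}_{k+1}=\mathbf{x}_k+\alpha_k\mathbf{d}_k$. 5. Compute the next Hessian approximation $B_{k+1}$,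 and increase $k$ by $1$. So $B_k$ is available at the start of iteration $k$, before $\mathcal{N}_k$ is drawn. **Notation and standing assumption.** $\mathcal{F}_k$ is the $\sigma$-algebra generated by $\mathbf{x}_0,\dots,\mathbf{x}_k$. It is assumed throughout that $\mathbf{g}_k$ and $B_k$ are conditionally independent given $\mathcal{F}_k$, in the sense that $\mathbb{E}(B_k\mathbf{g}_k\mid\mathcal{F}_k)=B_k\,\mathbb{E}(\mathbf{g}_k\mid\mathcal{F}_k)$. **Assumptions.** (A1) $\phi$ is bounded from below by $\phi^*$, and the functions $\phi_i$ have Lipschitz-continuous gradients with Lipschitz constant $L$. (A2) There exist $\mu,L>0$ (the same $L$ as in (A1), without loss of generality) such that $\mu I\preceq B_k\preceq LI$ for all $k$ ($B_k$ symmetric). (A3) There is a constant $\bar c_1>0$ such that for all $k$: $\mathbb{E}(\mathbf{g}_k\mid\mathcal{F}_k)=\nabla\phi(\mathbf{x}_k)$ and $\mathbb{E}(\|\nabla\phi(\mathbf{x}_k)-\mathbf{g}_k\|^2\mid\mathcal{F}_k)\le\bar c_1$. (A4) $\sum_{k=1}^\infty\zeta_k<\infty$; $\sum_{k=0}^\infty\alpha_k=\infty$; $\sum_{k=1}^\infty\alpha_k^2<\infty$; $\delta_k\to0$; $\sum_{k=1}^\infty\delta_k\alpha_k<\infty$.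
   Formalization: Conditional independence of g_k and B_k given F_k is assumed in the standard sense, in addition to the identity E(B_k g_k | F_k) = B_k E(g_k | F_k); with the identity alone the claim fails, because the step uses the inverse of B_k. *)

theory Defs
  imports "HOL-Probability.Probability"
begin

definition gradient :: "('a::real_inner \<Rightarrow> real) \<Rightarrow> 'a \<Rightarrow> 'a" where
  "gradient f x = (THE D. GDERIV f x :> D)"

definition twice_continuously_differentiable :: "(real ^ 'n \<Rightarrow> real) \<Rightarrow> bool" where
  "twice_continuously_differentiable f \<longleftrightarrow>
     (\<forall>x. f differentiable (at x)) \<and>
     (\<exists>H :: real ^ 'n \<Rightarrow> real ^ 'n ^ 'n. continuous_on UNIV H \<and>
        (\<forall>x. (gradient f has_derivative (\<lambda>h. H x *v h)) (at x)))"

definition strongly_convex :: "real \<Rightarrow> ('a::real_inner \<Rightarrow> real) \<Rightarrow> bool" where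
  "strongly_convex \<mu> f \<longleftrightarrow>
     (\<forall>x y. \<forall>s\<in>{0..1}. f (s *\<^sub>R x + (1 - s) *\<^sub>R y)
        \<le> s * f x + (1 - s) * f y - \<mu> / 2 * s * (1 - s) * (norm (x - y))\<^sup>2)"

text \<open>The Loewner order; symmetry of the matrices is required separately where it is used.\<close>

definition loewner_le :: "real ^ 'n ^ 'n \<Rightarrow> real ^ 'n ^ 'n \<Rightarrow> bool" where
  "loewner_le A B \<longleftrightarrow> (\<forall>v. v \<bullet> (A *v v) \<le> v \<bullet> (B *v v))"

definition avg :: "(nat \<Rightarrow> 'a \<Rightarrow> real) \<Rightarrow> nat set \<Rightarrow> 'a \<Rightarrow> real" where
  "avg \<phi> S x = (\<Sum>i\<in>S. \<phi> i x) / real (card S)"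

definition avg_grad :: "(nat \<Rightarrow> 'a::real_inner \<Rightarrow> real) \<Rightarrow> nat set \<Rightarrow> 'a \<Rightarrow> 'a" where
  "avg_grad \<phi> S x = (\<Sum>i\<in>S. gradient (\<phi> i) x) /\<^sub>R real (card S)"

definition preimages :: "'a measure \<Rightarrow> 'b measure \<Rightarrow> ('a \<Rightarrow> 'b) \<Rightarrow> 'a set set" where
  "preimages M S X = {X -` A \<inter> space M | A. A \<in> sets S}"

definition iterates_algebra ::
  "'a measure \<Rightarrow> (nat \<Rightarrow> 'a \<Rightarrow> 'b::topological_space) \<Rightarrow> nat \<Rightarrow> 'a measure" where
  "iterates_algebra M x k = sigma (space M) (\<Union>j\<le>k. preimages M borel (x j))"

definition vec_cond_exp ::
  "'a measure \<Rightarrow> 'a measure \<Rightarrow> ('a \<Rightarrow> real ^ 'n) \<Rightarrow> 'a \<Rightarrow> real ^ 'n" where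
  "vec_cond_exp M F X \<omega> = (\<chi> i. real_cond_exp M F (\<lambda>\<omega>'. X \<omega>' $ i) \<omega>)"

definition cond_indep_var :: "'a measure \<Rightarrow> 'a measure \<Rightarrow>
    ('a \<Rightarrow> 'b::topological_space) \<Rightarrow> ('a \<Rightarrow> 'c::topological_space) \<Rightarrow> bool" where
  "cond_indep_var M F X Y \<longleftrightarrow>
     (\<forall>A\<in>sets borel. \<forall>C\<in>sets borel. AE \<omega> in M.
        real_cond_exp M F (\<lambda>\<omega>'. indicator A (X \<omega>') * indicator C (Y \<omega>')) \<omega>
        = real_cond_exp M F (\<lambda>\<omega>'. indicator A (X \<omega>')) \<omega>
          * real_cond_exp M F (\<lambda>\<omega>'. indicator C (Y \<omega>')) \<omega>)"

text \<open>
  The events of the past of iteration \<open>k\<close> are generated by all that has been computed before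
  the sample \<open>Ns k\<close> is drawn; this includes \<open>B k\<close>. The step lengths, the rejection counter and
  the phase flag are functions of these quantities and need not be listed.
\<close>

definition past_events :: "'a measure \<Rightarrow> nat \<Rightarrow>
    (nat \<Rightarrow> 'a \<Rightarrow> real ^ 'n) \<Rightarrow> (nat \<Rightarrow> 'a \<Rightarrow> real ^ 'n ^ 'n) \<Rightarrow> (nat \<Rightarrow> 'a \<Rightarrow> nat set) \<Rightarrow>
    (nat \<Rightarrow> 'a \<Rightarrow> real ^ 'n) \<Rightarrow> (nat \<Rightarrow> 'a \<Rightarrow> real ^ 'n) \<Rightarrow> (nat \<Rightarrow> 'a \<Rightarrow> nat set) \<Rightarrow>
    nat \<Rightarrow> 'a set set" where
  "past_events M N x B Ns g d Ds k =
     (\<Union>j\<le>k. preimages M borel (x j) \<union> preimages M borel (B j)) \<union>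
     (\<Union>j<k. preimages M (count_space (Pow {1..N})) (Ns j) \<union>
            preimages M borel (g j) \<union> preimages M borel (d j) \<union>
            preimages M (count_space (Pow {1..N})) (Ds j))"

definition before_Ns :: "'a measure \<Rightarrow> nat \<Rightarrow>
    (nat \<Rightarrow> 'a \<Rightarrow> real ^ 'n) \<Rightarrow> (nat \<Rightarrow> 'a \<Rightarrow> real ^ 'n ^ 'n) \<Rightarrow> (nat \<Rightarrow> 'a \<Rightarrow> nat set) \<Rightarrow>
    (nat \<Rightarrow> 'a \<Rightarrow> real ^ 'n) \<Rightarrow> (nat \<Rightarrow> 'a \<Rightarrow> real ^ 'n) \<Rightarrow> (nat \<Rightarrow> 'a \<Rightarrow> nat set) \<Rightarrow>
    nat \<Rightarrow> 'a measure" where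
  "before_Ns M N x B Ns g d Ds k = sigma (space M) (past_events M N x B Ns g d Ds k)"

definition before_Ds :: "'a measure \<Rightarrow> nat \<Rightarrow>
    (nat \<Rightarrow> 'a \<Rightarrow> real ^ 'n) \<Rightarrow> (nat \<Rightarrow> 'a \<Rightarrow> real ^ 'n ^ 'n) \<Rightarrow> (nat \<Rightarrow> 'a \<Rightarrow> nat set) \<Rightarrow>
    (nat \<Rightarrow> 'a \<Rightarrow> real ^ 'n) \<Rightarrow> (nat \<Rightarrow> 'a \<Rightarrow> real ^ 'n) \<Rightarrow> (nat \<Rightarrow> 'a \<Rightarrow> nat set) \<Rightarrow>
    nat \<Rightarrow> 'a measure" where
  "before_Ds M N x B Ns g d Ds k = sigma (space M)
     (past_events M N x B Ns g d Ds k \<union> preimages M (count_space (Pow {1..N})) (Ns k) \<union>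
      preimages M borel (g k) \<union> preimages M borel (d k))"

text \<open>
  On the event \<open>E\<close>, \<open>D\<close> is a nonempty sample from \<open>{1..N}\<close> drawn uniformly and independently of
  \<open>G\<close>: whatever has happened in \<open>G\<close> and whatever the size \<open>s\<close> of the sample, each of the
  \<open>N choose s\<close> subsets of that size is equally likely. The size is arbitrary; it may be fixed in
  advance, random, or chosen from the information in \<open>G\<close>. If it is not random, and \<open>E\<close> is the
  whole space, then this says exactly that \<open>D\<close> is independent of \<open>G\<close> and uniformly distributed
  on the subsets of that size. Outside \<open>E\<close>, no sample is drawn and \<open>D\<close> is a dummy.
\<close>

definition uniform_sample ::
  "'a measure \<Rightarrow> 'a measure \<Rightarrow> 'a set \<Rightarrow> nat \<Rightarrow> ('a \<Rightarrow> nat set) \<Rightarrow> bool" where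
  "uniform_sample M G E N D \<longleftrightarrow>
     D \<in> measurable M (count_space (Pow {1..N})) \<and>
     (\<forall>\<omega>\<in>E. D \<omega> \<noteq> {}) \<and>
     (\<forall>A\<in>sets G. \<forall>S\<subseteq>{1..N}.
        measure M {\<omega> \<in> A \<inter> E. D \<omega> = S}
        = measure M {\<omega> \<in> A \<inter> E. card (D \<omega>) = card S} / real (N choose card S))"

definition nonmonotone_armijo ::
  "('a::real_inner \<Rightarrow> real) \<Rightarrow> real \<Rightarrow> real \<Rightarrow> 'a \<Rightarrow> 'a \<Rightarrow> 'a \<Rightarrow> real \<Rightarrow> bool" where
  "nonmonotone_armijo f \<eta> \<zeta> x g d t \<longleftrightarrow> f (x + t *\<^sub>R d) \<le> f x + \<eta> * t * (g \<bullet> d) + \<zeta>"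

definition sample_decrease :: "(nat \<Rightarrow> 'a::real_inner \<Rightarrow> real) \<Rightarrow> nat set \<Rightarrow>
    real \<Rightarrow> real \<Rightarrow> real \<Rightarrow> 'a \<Rightarrow> 'a \<Rightarrow> bool" where
  "sample_decrease \<phi> S cmin Cmax \<zeta> x xbar \<longleftrightarrow>
     avg \<phi> S xbar \<le> avg \<phi> S x - cmin * (norm (avg_grad \<phi> S x))\<^sup>2 + Cmax * \<zeta>"

end

theory Submission
  imports Defs
begin

text \<open>
  Let \<open>V k = \<phi> (x k) - \<phi> xstar\<close>. The phase flag is in general not measurable with respect to the
  algebra of the iterates, so one cannot condition on being in the second phase. Instead both
  phases are shown to obey one and the same recursion.

  In the first phase there are at most \<open>Kmax + 1\<close> rejections. If the acceptance test, averaged over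
  all samples of the drawn size, fails at the trial point, then at least one such sample rejects, and
  since samples are uniform the probability of rejection is at least \<open>2 ^ -N\<close> times that of this
  event. Hence the probabilities that a first-phase step fails to satisfy
  \<open>\<phi> (x (k+1)) \<le> \<phi> (x k) - cmin |\<nabla>\<phi> (x k)|\<^sup>2 + Cmax \<zeta> k\<close> are summable. By completing the square, a step
  with this decrease also satisfies, whatever \<open>d k\<close> is, the estimate that the descent lemma gives for
  \<open>x k + \<alpha> k d k\<close>, with a larger constant in front of \<open>(\<alpha> k)\<^sup>2 |d k|\<^sup>2\<close>. As \<open>d k\<close> and \<open>g k\<close> satisfy the
  assumptions in both phases, taking expectations over events of the iterates' algebra gives, for
  every level \<open>b\<close>, an almost-supermartingale inequality for \<open>min (V k) b\<close> with drift
  \<open>- const * \<alpha> k * V k\<close> below \<open>b\<close> and summable errors.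

  A maximal inequality then finishes the proof: it bounds \<open>V\<close> with high probability; divergence of
  \<open>\<Sum> \<alpha> k\<close> makes the truncated expectation of \<open>V k\<close> small for some large \<open>k\<close>; and the maximal
  inequality from that \<open>k\<close> on, at a small level, keeps \<open>V\<close> small for ever.
\<close>

section \<open>Smooth and strongly convex functions\<close>

lemma GDERIV_unique:
  assumes "GDERIV f x :> D" "GDERIV f x :> D'"
  shows "D = D'"
proof -
  have "(\<lambda>h. h \<bullet> D) = (\<lambda>h. h \<bullet> D')"
    using assms unfolding gderiv_def by (rule has_derivative_unique)
  hence "(D - D') \<bullet> D = (D - D') \<bullet> D'" by metis
  hence "(D - D') \<bullet> (D - D') = 0" by (simp add: inner_diff_right)
  thus ?thesis by simp
qed

lemma gradient_eqI: "GDERIV f x :> D \<Longrightarrow> gradient f x = D"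
  unfolding gradient_def by (rule the_equality) (auto intro: GDERIV_unique)

text \<open>\<open>gradient\<close> is a \<open>THE\<close>, so it is meaningful only once some
  gradient exists. The witness is the Riesz representative of the derivative, assembled from its
  values on the basis.\<close>

lemma differentiable_imp_GDERIV_gradient:
  fixes f :: "'a::euclidean_space \<Rightarrow> real"
  assumes "f differentiable (at x)"
  shows "GDERIV f x :> gradient f x"
proof -
  obtain f' where f': "(f has_derivative f') (at x)"
    using assms unfolding differentiable_def by blast
  interpret bounded_linear f' using f' by (rule has_derivative_bounded_linear)
  have "f' h = h \<bullet> (\<Sum>b\<in>Basis. f' b *\<^sub>R b)" for h
  proof -
    have "f' h = f' (\<Sum>b\<in>Basis. (h \<bullet> b) *\<^sub>R b)" by (simp add: euclidean_representation)
    also have "\<dots> = (\<Sum>b\<in>Basis. (h \<bullet> b) * f' b)" by (simp add: sum scaleR)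
    also have "\<dots> = h \<bullet> (\<Sum>b\<in>Basis. f' b *\<^sub>R b)"
      by (simp add: inner_sum_right mult.commute)
    finally show ?thesis .
  qed
  hence "f' = (\<lambda>h. h \<bullet> (\<Sum>b\<in>Basis. f' b *\<^sub>R b))" by (rule ext)
  hence "GDERIV f x :> (\<Sum>b\<in>Basis. f' b *\<^sub>R b)"
    using f' unfolding gderiv_def by metis
  thus ?thesis using gradient_eqI by metis
qed

lemma GDERIV_avg:
  assumes "\<And>i. i \<in> S \<Longrightarrow> GDERIV (\<phi> i) x :> gradient (\<phi> i) x"
  shows "GDERIV (avg \<phi> S) x :> avg_grad \<phi> S x"
proof -
  have "((\<lambda>x. (\<Sum>i\<in>S. \<phi> i x) / real (card S)) has_derivative
      (\<lambda>h. (\<Sum>i\<in>S. h \<bullet> gradient (\<phi> i) x) / real (card S))) (at x)"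
    using assms unfolding gderiv_def
    by (intro bounded_linear.has_derivative[OF bounded_linear_divide] has_derivative_sum) auto
  moreover have "(\<lambda>h. (\<Sum>i\<in>S. h \<bullet> gradient (\<phi> i) x) / real (card S)) = (\<lambda>h. h \<bullet> avg_grad \<phi> S x)"
    by (rule ext) (simp add: avg_grad_def inner_sum_right divide_inverse mult.commute)
  moreover have "(\<lambda>x. (\<Sum>i\<in>S. \<phi> i x) / real (card S)) = avg \<phi> S"
    by (rule ext) (simp add: avg_def)
  ultimately show ?thesis unfolding gderiv_def by simp
qed

lemma lipschitz_on_avg_grad:
  assumes "\<And>i. i \<in> S \<Longrightarrow> lipschitz_on L U (gradient (\<phi> i))" "S \<noteq> {}" "finite S"
  shows "lipschitz_on L U (avg_grad \<phi> S)"
proof (rule lipschitz_onI)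
  have c: "real (card S) > 0" using assms by (simp add: card_gt_0_iff)
  fix x y assume xy: "x \<in> U" "y \<in> U"
  have "dist (avg_grad \<phi> S x) (avg_grad \<phi> S y)
      = norm (\<Sum>i\<in>S. gradient (\<phi> i) x - gradient (\<phi> i) y) / card S"
    by (simp add: avg_grad_def dist_norm sum_subtractf divide_inverse
        flip: scaleR_diff_right)
  also have "\<dots> \<le> (\<Sum>i\<in>S. L * dist x y) / card S"
    using assms(1) xy
    by (intro divide_right_mono order.trans[OF norm_sum] sum_mono)
       (auto simp: lipschitz_on_def dist_norm)
  also have "\<dots> = L * dist x y" using c by simp
  finally show "dist (avg_grad \<phi> S x) (avg_grad \<phi> S y) \<le> L * dist x y" .
next
  show "0 \<le> L" using assms by (auto simp: lipschitz_on_def)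
qed

lemma has_real_derivative_along_line:
  assumes "\<And>x. GDERIV f x :> G x"
  shows "((\<lambda>s. f (x + s *\<^sub>R h)) has_real_derivative (h \<bullet> G (x + s *\<^sub>R h))) (at s within T)"
proof -
  have "((\<lambda>s. x + s *\<^sub>R h) has_derivative (\<lambda>r. r *\<^sub>R h)) (at s within T)"
    by (auto intro!: derivative_eq_intros)
  moreover have "(f has_derivative (\<lambda>v. v \<bullet> G (x + s *\<^sub>R h))) (at (x + s *\<^sub>R h))"
    using assms unfolding gderiv_def .
  ultimately have "((\<lambda>s. f (x + s *\<^sub>R h)) has_derivative
      (\<lambda>r. (r *\<^sub>R h) \<bullet> G (x + s *\<^sub>R h))) (at s within T)"
    by (rule has_derivative_compose)
  thus ?thesis unfolding has_field_derivative_def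
    by (rule has_derivative_eq_rhs) (auto simp: fun_eq_iff)
qed

text \<open>The mean value theorem along the segment replaces the usual integral. This costs the
  constant \<open>L\<close> instead of \<open>L / 2\<close>, which affects only the size of later
  error terms.\<close>

lemma lipschitz_gradient_upper_bound:
  assumes G: "\<And>x. GDERIV f x :> G x" and L: "lipschitz_on L UNIV G"
  shows "f (x + h) \<le> f x + h \<bullet> G x + L * (norm h)\<^sup>2"
proof -
  have "\<exists>s>0. s < 1 \<and> f (x + 1 *\<^sub>R h) - f (x + 0 *\<^sub>R h) = (1 - 0) * (h \<bullet> G (x + s *\<^sub>R h))"
    by (rule MVT2) (auto intro: has_real_derivative_along_line[OF G])
  then obtain s where s: "0 < s" "s < 1" and eq: "f (x + h) - f x = h \<bullet> G (x + s *\<^sub>R h)"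
    by auto
  have L0: "L \<ge> 0" using L by (simp add: lipschitz_on_def)
  have "h \<bullet> G (x + s *\<^sub>R h) - h \<bullet> G x = h \<bullet> (G (x + s *\<^sub>R h) - G x)"
    by (simp add: inner_diff_right)
  also have "\<dots> \<le> norm h * norm (G (x + s *\<^sub>R h) - G x)" by (rule norm_cauchy_schwarz)
  also have "norm (G (x + s *\<^sub>R h) - G x) \<le> L * norm (s *\<^sub>R h)"
    using lipschitz_onD[OF L, of "x + s *\<^sub>R h" x] by (simp add: dist_norm)
  also have "\<dots> \<le> L * norm h" using s L0 by (intro mult_left_mono) (auto simp: mult_left_le_one_le)
  also have "norm h * (L * norm h) = L * (norm h)\<^sup>2" by (simp add: power2_eq_square)
  finally show ?thesis using eq by (simp add: mult_left_mono)
qed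

text \<open>The displacement \<open>?h\<close> minimizes the quadratic upper bound of the descent
  lemma, and \<open>f\<close> is still at least \<open>m\<close> there. Later this bounds the
  gradient wherever the suboptimality is below a level.\<close>

lemma norm_gradient_le_suboptimality:
  assumes G: "\<And>x. GDERIV f x :> G x" and L: "lipschitz_on L UNIV G" "L > 0"
    and lb: "\<And>y. m \<le> f y"
  shows "(norm (G x))\<^sup>2 \<le> 4 * L * (f x - m)"
proof -
  let ?h = "- (1 / (2 * L)) *\<^sub>R G x"
  have "m \<le> f x + ?h \<bullet> G x + L * (norm ?h)\<^sup>2"
    using lipschitz_gradient_upper_bound[OF G L(1), of x ?h] lb[of "x + ?h"] by linarith
  also have "L * (norm ?h)\<^sup>2 = (norm (G x))\<^sup>2 / (4 * L)"
    using L(2) by (simp add: power_mult_distrib field_simps power2_eq_square)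
  also have "?h \<bullet> G x = - (norm (G x))\<^sup>2 / (2 * L)"
    by (simp add: power2_norm_eq_inner)
  finally show ?thesis using L(2) by (simp add: field_simps)
qed

text \<open>Strong convexity along the segment, divided by the parameter \<open>s\<close>, bounds a
  difference quotient; letting \<open>s\<close> decrease to 0 turns the quotient into the
  directional derivative.\<close>

lemma strongly_convex_first_order:
  assumes sc: "strongly_convex \<mu> f" and G: "\<And>x. GDERIV f x :> G x"
  shows "f x + (y - x) \<bullet> G x + \<mu> / 2 * (norm (y - x))\<^sup>2 \<le> f y"
proof -
  let ?q = "\<lambda>s. (f (x + s *\<^sub>R (y - x)) - f x) / s"
  have "((\<lambda>s. f (x + s *\<^sub>R (y - x))) has_real_derivative (y - x) \<bullet> G x) (at 0)"
    using has_real_derivative_along_line[OF G, of x "y - x" 0 UNIV] by simp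
  hence "?q \<midarrow>0\<rightarrow> (y - x) \<bullet> G x" by (simp add: DERIV_def)
  hence lim: "(?q \<longlongrightarrow> (y - x) \<bullet> G x) (at_right 0)"
    by (rule tendsto_within_subset) auto
  have "((\<lambda>s. f y - f x - \<mu> / 2 * (1 - s) * (norm (y - x))\<^sup>2) \<longlongrightarrow>
      f y - f x - \<mu> / 2 * (1 - 0) * (norm (y - x))\<^sup>2) (at_right 0)"
    by (intro tendsto_intros)
  moreover have "eventually (\<lambda>s. ?q s \<le> f y - f x - \<mu> / 2 * (1 - s) * (norm (y - x))\<^sup>2) (at_right 0)"
  proof -
    have "?q s \<le> f y - f x - \<mu> / 2 * (1 - s) * (norm (y - x))\<^sup>2" if s: "0 < s" "s < 1" for s
    proof -
      have "f (s *\<^sub>R y + (1 - s) *\<^sub>R x)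
          \<le> s * f y + (1 - s) * f x - \<mu> / 2 * s * (1 - s) * (norm (y - x))\<^sup>2"
        using sc s unfolding strongly_convex_def by auto
      moreover have "s *\<^sub>R y + (1 - s) *\<^sub>R x = x + s *\<^sub>R (y - x)" by (simp add: algebra_simps)
      ultimately show ?thesis using s by (simp add: field_simps)
    qed
    thus ?thesis unfolding eventually_at_right_field by (intro exI[of _ 1]) auto
  qed
  ultimately have "(y - x) \<bullet> G x \<le> f y - f x - \<mu> / 2 * (1 - 0) * (norm (y - x))\<^sup>2"
    using lim by (intro tendsto_le[where F="at_right 0"]) auto
  thus ?thesis by simp
qed

text \<open>Completing a square in the first-order lower bound gives the Polyak-Lojasiewicz
  inequality. It converts squared gradient norms into suboptimality and so supplies the drift of the
  recursion.\<close>

lemma strongly_convex_PL: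
  assumes sc: "strongly_convex \<mu> f" and G: "\<And>x. GDERIV f x :> G x" and \<mu>: "\<mu> > 0"
  shows "2 * \<mu> * (f x - f y) \<le> (norm (G x))\<^sup>2"
proof -
  have "0 \<le> (norm (G x + \<mu> *\<^sub>R (y - x)))\<^sup>2" by simp
  also have "\<dots> = (norm (G x))\<^sup>2 + 2 * \<mu> * ((y - x) \<bullet> G x) + \<mu>\<^sup>2 * (norm (y - x))\<^sup>2"
    unfolding power2_norm_eq_inner
    by (simp add: inner_add_left inner_add_right inner_commute power2_eq_square algebra_simps)
  also have "\<dots> = (norm (G x))\<^sup>2 + 2 * \<mu> * ((y - x) \<bullet> G x + \<mu> / 2 * (norm (y - x))\<^sup>2)"
    by (simp add: algebra_simps power2_eq_square)
  also have "\<dots> \<le> (norm (G x))\<^sup>2 + 2 * \<mu> * (f y - f x)"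
    using strongly_convex_first_order[OF sc G, of x y] \<mu>
    by (intro add_left_mono mult_left_mono) auto
  finally show ?thesis by (simp add: algebra_simps)
qed

lemma strongly_convex_minimizer:
  fixes f :: "'a::euclidean_space \<Rightarrow> real"
  assumes sc: "strongly_convex \<mu> f" and G: "\<And>x. GDERIV f x :> G x" and \<mu>: "\<mu> > 0"
  obtains z where "\<And>y. f z + \<mu> / 2 * (norm (y - z))\<^sup>2 \<le> f y"
proof -
  have cont: "continuous_on A f" for A
    using G unfolding gderiv_def
    by (meson continuous_at_imp_continuous_on has_derivative_continuous)
  \<comment> \<open>Beyond this radius the quadratic term of the first-order bound at 0 outweighs
    the linear one, so \<open>f\<close> is at least \<open>f 0\<close> there and the minimum over
    the compact ball is global.\<close>
  define R where "R = 2 / \<mu> * norm (G 0)"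
  have "R \<ge> 0" using \<mu> by (simp add: R_def)
  then obtain z where z: "z \<in> cball 0 R" "\<And>y. y \<in> cball 0 R \<Longrightarrow> f z \<le> f y"
    using continuous_attains_inf[OF compact_cball _ cont, of 0 R] by auto
  have zmin: "f z \<le> f y" for y
  proof (cases "y \<in> cball 0 R")
    case False
    hence y: "norm y > R" by simp
    have "- (norm y * norm (G 0)) \<le> y \<bullet> G 0" using Cauchy_Schwarz_ineq2[of y "G 0"] by linarith
    moreover have "norm y * norm (G 0) \<le> \<mu> / 2 * (norm y)\<^sup>2"
    proof -
      have "norm (G 0) \<le> \<mu> / 2 * norm y" using y \<mu> by (simp add: R_def field_simps)
      hence "norm y * norm (G 0) \<le> norm y * (\<mu> / 2 * norm y)" by (intro mult_left_mono) auto
      thus ?thesis by (simp add: power2_eq_square mult_ac)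
    qed
    ultimately have "f 0 \<le> f y" using strongly_convex_first_order[OF sc G, of 0 y] by simp
    moreover have "f z \<le> f 0" using \<open>R \<ge> 0\<close> by (intro z(2)) simp
    ultimately show ?thesis by linarith
  qed (use z in auto)
  have "G z = 0"
  proof -
    have "((\<lambda>h. h \<bullet> G z) = (\<lambda>h. 0))"
      using zmin G[of z] unfolding gderiv_def
      by (intro has_derivative_local_min[of f]) auto
    hence "G z \<bullet> G z = 0" by metis
    thus ?thesis by simp
  qed
  hence "f z + \<mu> / 2 * (norm (y - z))\<^sup>2 \<le> f y" for y
    using strongly_convex_first_order[OF sc G, of z y] by simp
  thus ?thesis by (rule that)
qed

section \<open>Quasi-Newton systems\<close>

lemma loewner_matD:
  assumes "loewner_le (mat \<mu>) B"
  shows "\<mu> * (norm v)\<^sup>2 \<le> v \<bullet> (B *v v)"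
proof -
  have "mat \<mu> *v v = \<mu> *\<^sub>R v"
    by (simp add: vec_eq_iff matrix_vector_mult_def mat_def if_distrib if_distribR cong: if_cong)
  thus ?thesis using assms unfolding loewner_le_def
    by (metis inner_scaleR_right power2_norm_eq_inner)
qed

lemma loewner_matD':
  assumes "loewner_le B (mat L)"
  shows "v \<bullet> (B *v v) \<le> L * (norm v)\<^sup>2"
proof -
  have "mat L *v v = L *\<^sub>R v"
    by (simp add: vec_eq_iff matrix_vector_mult_def mat_def if_distrib if_distribR cong: if_cong)
  thus ?thesis using assms unfolding loewner_le_def
    by (metis inner_scaleR_right power2_norm_eq_inner)
qed

lemma inner_symmetric_matrix:
  fixes B :: "real ^ 'n ^ 'n"
  assumes "transpose B = B"
  shows "v \<bullet> (B *v w) = (B *v v) \<bullet> w"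
  using assms by (metis dot_lmul_matrix matrix_vector_mul_assoc transpose_matrix_vector)

lemma norm_le_loewner_lower:
  assumes "loewner_le (mat \<mu>) B" "\<mu> > 0"
  shows "norm v \<le> norm (B *v v) / \<mu>"
proof (cases "v = 0")
  case False
  have "\<mu> * (norm v)\<^sup>2 \<le> norm v * norm (B *v v)"
    using loewner_matD[OF assms(1), of v] norm_cauchy_schwarz[of v "B *v v"] by linarith
  hence "\<mu> * norm v \<le> norm (B *v v)" using False by (simp add: power2_eq_square)
  thus ?thesis using assms(2) by (simp add: field_simps)
qed auto

text \<open>Positivity of the form at \<open>v - (1 / L) *\<^sub>R (B *v v)\<close> gives the bound
  without square roots or a spectral decomposition. With \<open>B *v v = u\<close> it bounds
  \<open>v \<bullet> u\<close> below by \<open>(norm u)\<^sup>2 / L\<close>, the descent part of a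
  quasi-Newton direction.\<close>

lemma norm_mult_le_loewner_upper:
  fixes B :: "real ^ 'n ^ 'n"
  assumes sym: "transpose B = B" and pos: "\<And>w. 0 \<le> w \<bullet> (B *v w)"
    and L: "loewner_le B (mat L)" "L > 0"
  shows "(norm (B *v v))\<^sup>2 \<le> L * (v \<bullet> (B *v v))"
proof -
  define z where "z = B *v v"
  define w where "w = v - (1 / L) *\<^sub>R z"
  have "0 \<le> w \<bullet> (B *v w)" by (rule pos)
  also have "B *v w = z - (1 / L) *\<^sub>R (B *v z)"
    by (simp add: w_def z_def matrix_vector_mult_diff_distrib matrix_vector_mult_scaleR)
  also have "w \<bullet> \<dots> = v \<bullet> z - (1 / L) * (v \<bullet> (B *v z)) - (1 / L) * (z \<bullet> z)
      + (1 / L) * ((1 / L) * (z \<bullet> (B *v z)))"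
    by (simp add: w_def inner_diff_left inner_diff_right algebra_simps)
  also have "v \<bullet> (B *v z) = z \<bullet> z" unfolding inner_symmetric_matrix[OF sym] z_def ..
  also have "(1 / L) * (z \<bullet> (B *v z)) \<le> (1 / L) * (L * (norm z)\<^sup>2)"
    using loewner_matD'[OF L(1), of z] L(2) by (intro mult_left_mono) auto
  also have "\<dots> = z \<bullet> z" using L(2) by (simp add: power2_norm_eq_inner)
  finally have "0 \<le> v \<bullet> z - (1 / L) * (z \<bullet> z)" using L(2) by (simp add: divide_right_mono)
  thus ?thesis using L(2) by (simp add: z_def power2_norm_eq_inner field_simps)
qed

text \<open>Cramer's rule makes the solution total, with entries that are quotients of polynomials
  in the entries of \<open>A\<close> and \<open>b\<close>. Its measurability in random data is then
  immediate.\<close>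

definition cramer_solution :: "real ^ 'n ^ 'n \<Rightarrow> real ^ 'n \<Rightarrow> real ^ 'n" where
  "cramer_solution A b = (\<chi> k. det (\<chi> i j. if j = k then b $ i else A $ i $ j) / det A)"

lemma cramer_solution:
  assumes "loewner_le (mat \<mu>) B" "\<mu> > 0"
  shows "B *v cramer_solution B u = u"
proof -
  have "v = 0" if "B *v v = 0" for v
    using norm_le_loewner_lower[OF assms, of v] that by simp
  hence "invertible B"
    unfolding invertible_left_inverse matrix_left_invertible_ker by blast
  hence "det B \<noteq> 0" by (simp add: invertible_det_nz)
  from cramer[OF this, of "cramer_solution B u" u] show ?thesis
    unfolding cramer_solution_def by simp
qed

lemma borel_measurable_vec_nth:
  fixes f :: "'a \<Rightarrow> real ^ 'n"
  assumes "f \<in> borel_measurable M"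
  shows "(\<lambda>x. f x $ i) \<in> borel_measurable M"
  by (rule borel_measurable_continuous_on[OF _ assms]) (intro continuous_intros)

lemma borel_measurable_matrix_nth:
  fixes f :: "'a \<Rightarrow> real ^ 'n ^ 'm"
  assumes "f \<in> borel_measurable M"
  shows "(\<lambda>x. f x $ i $ j) \<in> borel_measurable M"
  by (rule borel_measurable_continuous_on[OF _ assms]) (intro continuous_intros)

lemma borel_measurable_det:
  fixes A :: "'a \<Rightarrow> real ^ 'n ^ 'n"
  assumes "\<And>i j. (\<lambda>x. A x $ i $ j) \<in> borel_measurable M"
  shows "(\<lambda>x. det (A x)) \<in> borel_measurable M"
  unfolding det_def using assms
  by (intro borel_measurable_sum borel_measurable_times borel_measurable_prod borel_measurable_const)

lemma borel_measurable_cramer_solution: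
  fixes B :: "'a \<Rightarrow> real ^ 'n ^ 'n"
  assumes "B \<in> borel_measurable M" "u \<in> borel_measurable M"
  shows "(\<lambda>x. cramer_solution (B x) (u x) $ k) \<in> borel_measurable M"
proof -
  have "(\<lambda>x. (\<chi> i j. if j = k then u x $ i else B x $ i $ j) $ i $ j) \<in> borel_measurable M" for i j
    using borel_measurable_matrix_nth[OF assms(1)] borel_measurable_vec_nth[OF assms(2)]
    by (cases "j = k") auto
  thus ?thesis unfolding cramer_solution_def
    by (auto intro!: borel_measurable_divide borel_measurable_det
        borel_measurable_matrix_nth[OF assms(1)])
qed

section \<open>Conditional independence and orthogonality\<close>

text \<open>The generators are intersections, not the union of the two families, so that they form a
  pi-system and Dynkin induction applies.\<close>

definition join_algebra :: "'a measure \<Rightarrow> 'a measure \<Rightarrow> ('a \<Rightarrow> 'b::topological_space) \<Rightarrow> 'a measure" where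
  "join_algebra M F W = sigma (space M) {A \<inter> (W -` C \<inter> space M) |A C. A \<in> sets F \<and> C \<in> sets borel}"

lemma
  assumes F: "subalgebra M F" and W: "W \<in> borel_measurable M"
  shows subalgebra_join_algebra: "subalgebra M (join_algebra M F W)"
    and subalgebra_join_algebra_left: "subalgebra (join_algebra M F W) F"
    and measurable_join_algebra_right: "W \<in> borel_measurable (join_algebra M F W)"
    and Int_stable_join_algebra:
      "Int_stable {A \<inter> (W -` C \<inter> space M) |A C. A \<in> sets F \<and> C \<in> sets borel}"
proof -
  let ?G = "{A \<inter> (W -` C \<inter> space M) |A C. A \<in> sets F \<and> C \<in> sets borel}"
  have GM: "?G \<subseteq> sets M"
    using F measurable_sets[OF W] by (auto simp: subalgebra_def)
  hence P: "?G \<subseteq> Pow (space M)" using sets.space_closed by blast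
  have sp: "space (join_algebra M F W) = space M"
    unfolding join_algebra_def by (rule space_measure_of[OF P])
  have st: "sets (join_algebra M F W) = sigma_sets (space M) ?G"
    unfolding join_algebra_def by (rule sets_measure_of[OF P])
  show "subalgebra M (join_algebra M F W)"
    unfolding subalgebra_def sp st using sets.sigma_sets_subset[OF GM] by simp
  have spF: "space F = space M" using F by (simp add: subalgebra_def)
  have "A \<in> ?G" if "A \<in> sets F" for A
    using that sets.sets_into_space[OF that] spF
    by (intro CollectI exI[of _ A] exI[of _ UNIV]) auto
  thus "subalgebra (join_algebra M F W) F"
    unfolding subalgebra_def sp st spF by (auto intro: sigma_sets.Basic)
  show "W \<in> borel_measurable (join_algebra M F W)"
  proof (rule measurableI)
    fix C :: "'b set" assume "C \<in> sets borel"
    hence "W -` C \<inter> space M \<in> ?G"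
      using spF sets.top[of F] by (intro CollectI exI[of _ "space F"] exI[of _ C]) auto
    thus "W -` C \<inter> space (join_algebra M F W) \<in> sets (join_algebra M F W)"
      unfolding sp st by (rule sigma_sets.Basic)
  qed simp
  show "Int_stable ?G"
  proof (rule Int_stableI)
    fix a b assume "a \<in> ?G" "b \<in> ?G"
    then obtain A A' C C' where *: "a = A \<inter> (W -` C \<inter> space M)" "b = A' \<inter> (W -` C' \<inter> space M)"
        "A \<in> sets F" "A' \<in> sets F" "C \<in> sets borel" "C' \<in> sets borel" by blast
    hence "a \<inter> b = (A \<inter> A') \<inter> (W -` (C \<inter> C') \<inter> space M)" by auto
    moreover have "A \<inter> A' \<in> sets F" "C \<inter> C' \<in> sets borel" using * by auto
    ultimately show "a \<inter> b \<in> ?G" by blast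
  qed
qed

lemma (in prob_space) sigma_finite_subalgebraI:
  "subalgebra M F \<Longrightarrow> sigma_finite_subalgebra M F"
  by (intro finite_measure_subalgebra_is_sigma_finite finite_measure_subalgebra.intro
      finite_measure_subalgebra_axioms.intro finite_measure_axioms)

text \<open>Orthogonality on the generating pi-system spreads to the whole joined algebra by Dynkin
  induction, so the conditional expectation of \<open>X\<close> given that algebra vanishes. The
  measurable factor \<open>Y\<close>, possibly unbounded, is then pulled out.\<close>

lemma (in prob_space) expectation_orthogonal_join_algebra:
  fixes X Y :: "'a \<Rightarrow> real"
  assumes F: "subalgebra M F" and W: "W \<in> borel_measurable M" and X: "integrable M X"
    and orth: "\<And>A C. A \<in> sets F \<Longrightarrow> C \<in> sets borel \<Longrightarrow>
      (\<integral>\<omega>. indicator A \<omega> * (indicator C (W \<omega>) * X \<omega>) \<partial>M) = 0"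
    and Y: "Y \<in> borel_measurable (join_algebra M F W)" and YX: "integrable M (\<lambda>\<omega>. Y \<omega> * X \<omega>)"
  shows "(\<integral>\<omega>. Y \<omega> * X \<omega> \<partial>M) = 0"
proof -
  let ?G = "{A \<inter> (W -` C \<inter> space M) |A C. A \<in> sets F \<and> C \<in> sets borel}"
  let ?H = "join_algebra M F W"
  have HM: "subalgebra M ?H" using F W by (rule subalgebra_join_algebra)
  have spF: "space F = space M" using F by (simp add: subalgebra_def)
  interpret H: sigma_finite_subalgebra M ?H using HM by (rule sigma_finite_subalgebraI)
  have GM: "?G \<subseteq> sets M"
    using F measurable_sets[OF W] by (auto simp: subalgebra_def)
  hence P: "?G \<subseteq> Pow (space M)" using sets.space_closed by blast
  have st: "sets ?H = sigma_sets (space M) ?G"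
    unfolding join_algebra_def by (rule sets_measure_of[OF P])
  have HsubM: "D \<in> sets M" if "D \<in> sigma_sets (space M) ?G" for D
    using HM that unfolding subalgebra_def st by blast
  have sint: "set_integrable M D X" if "D \<in> sets M" for D
    unfolding set_integrable_def using integrable_mult_indicator[OF that X] by simp
  \<comment> \<open>The whole space is one of the generators; the resulting mean zero is needed for
    complements in the induction.\<close>
  have total: "(\<integral>\<omega>. X \<omega> \<partial>M) = 0"
  proof -
    have "(\<integral>\<omega>. X \<omega> \<partial>M) = (\<integral>\<omega>. indicator (space F) \<omega> * (indicator UNIV (W \<omega>) * X \<omega>) \<partial>M)"
      by (rule Bochner_Integration.integral_cong) (auto simp: spF)
    thus ?thesis using orth[of "space F" UNIV] by simp
  qed
  have "(\<integral>\<omega>\<in>D. X \<omega> \<partial>M) = 0" if "D \<in> sets ?H" for D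
    using Int_stable_join_algebra[OF F W] P that[unfolded st]
  proof (induction rule: sigma_sets_induct_disjoint)
    case (basic D)
    then obtain A C where D: "D = A \<inter> (W -` C \<inter> space M)" "A \<in> sets F" "C \<in> sets borel" by blast
    have "(\<integral>\<omega>\<in>D. X \<omega> \<partial>M) = (\<integral>\<omega>. indicator A \<omega> * (indicator C (W \<omega>) * X \<omega>) \<partial>M)"
      unfolding set_lebesgue_integral_def
      by (rule Bochner_Integration.integral_cong) (auto simp: D(1) indicator_def)
    thus ?case using orth D by simp
  next
    case empty
    show ?case by (simp add: set_lebesgue_integral_def)
  next
    case (compl D)
    have D: "D \<in> sets M" using compl.hyps by (rule HsubM)
    have "(\<integral>\<omega>\<in>space M - D. X \<omega> \<partial>M) = (\<integral>\<omega>. X \<omega> - indicator D \<omega> *\<^sub>R X \<omega> \<partial>M)"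
      unfolding set_lebesgue_integral_def
      by (rule Bochner_Integration.integral_cong) (auto simp: indicator_def)
    also have "\<dots> = (\<integral>\<omega>. X \<omega> \<partial>M) - (\<integral>\<omega>\<in>D. X \<omega> \<partial>M)"
      unfolding set_lebesgue_integral_def using X sint[OF D]
      by (intro Bochner_Integration.integral_diff) (auto simp: set_integrable_def)
    finally show ?case using total compl by simp
  next
    case (union D)
    have D: "\<And>i. D i \<in> sets M" using union.hyps by (auto intro: HsubM)
    have "(\<integral>\<omega>\<in>(\<Union>i. D i). X \<omega> \<partial>M) = (\<Sum>i. (\<integral>\<omega>\<in>D i. X \<omega> \<partial>M))"
      using union.hyps(1) D
      by (intro lebesgue_integral_countable_add) (auto intro!: sint simp: disjoint_family_on_def)
    thus ?case using union.IH by simp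
  qed
  hence "AE \<omega> in M. real_cond_exp M ?H X \<omega> = 0"
    by (intro H.real_cond_exp_charact) (auto simp: X set_lebesgue_integral_def)
  hence "(\<integral>\<omega>. Y \<omega> * real_cond_exp M ?H X \<omega> \<partial>M) = (\<integral>\<omega>. 0 \<partial>M)"
    using measurable_from_subalg[OF HM Y]
    by (intro integral_cong_AE) auto
  thus ?thesis using H.real_cond_exp_intg(2)[OF YX Y] X by simp
qed

text \<open>Serves to show that the gradient noise is orthogonal to whatever is computed from the
  past iterates and the Hessian approximation. \<open>cond_indep_var\<close> speaks of indicators,
  so the orthogonality lemma is used twice: to pass from indicators of \<open>U\<close> to
  \<open>f (U \<omega>)\<close>, and from indicators of \<open>W\<close> to \<open>Y\<close>. The
  set \<open>A\<close> is carried along because integrability of \<open>f (U \<omega>)\<close> is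
  assumed on \<open>A\<close> only.\<close>

lemma (in prob_space) cond_indep_var_residual_orthogonal:
  fixes f :: "'b::topological_space \<Rightarrow> real" and v Y :: "'a \<Rightarrow> real"
    and W :: "'a \<Rightarrow> 'c::topological_space"
  assumes F: "subalgebra M F" and ci: "cond_indep_var M F U W"
    and U: "U \<in> borel_measurable M" and W: "W \<in> borel_measurable M"
    and f: "f \<in> borel_measurable borel" and A: "A \<in> sets F"
    and int: "integrable M (\<lambda>\<omega>. indicator A \<omega> * f (U \<omega>))"
    and v: "v \<in> borel_measurable F" "AE \<omega> in M. real_cond_exp M F (\<lambda>\<omega>. f (U \<omega>)) \<omega> = v \<omega>"
    and Y: "Y \<in> borel_measurable (join_algebra M F W)"
    and YX: "integrable M (\<lambda>\<omega>. Y \<omega> * (indicator A \<omega> * (f (U \<omega>) - v \<omega>)))"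
  shows "(\<integral>\<omega>. Y \<omega> * (indicator A \<omega> * (f (U \<omega>) - v \<omega>)) \<partial>M) = 0"
proof -
  note [measurable] = U W f
  interpret F: sigma_finite_subalgebra M F using F by (rule sigma_finite_subalgebraI)
  have FM: "D \<in> sets M" if "D \<in> sets F" for D using F that by (auto simp: subalgebra_def)
  note [measurable] = FM[OF A]
  have vM[measurable]: "v \<in> borel_measurable M" using measurable_from_subalg[OF F v(1)] .
  have indF: "indicator D \<in> borel_measurable F" if "D \<in> sets F" for D :: "'a set"
    using that by simp
  have fUM: "(\<lambda>\<omega>. f (U \<omega>)) \<in> borel_measurable M" by measurable
  have Av: "integrable M (\<lambda>\<omega>. indicator A \<omega> * v \<omega>)"
  proof -
    have "integrable M (\<lambda>\<omega>. indicator A \<omega> * real_cond_exp M F (\<lambda>\<omega>. f (U \<omega>)) \<omega>)"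
      using F.real_cond_exp_intg(1)[OF int indF[OF A] fUM] .
    thus ?thesis by (rule integrable_cong_AE_imp) (use v(2) in auto)
  qed
  show ?thesis
  proof (rule expectation_orthogonal_join_algebra[OF F W _ _ Y YX])
    show "integrable M (\<lambda>\<omega>. indicator A \<omega> * (f (U \<omega>) - v \<omega>))"
      using Bochner_Integration.integrable_diff[OF int Av] by (simp add: algebra_simps)
    fix D :: "'a set" and C :: "'c set" assume D: "D \<in> sets F" and C[measurable]: "C \<in> sets borel"
    note [measurable] = FM[OF D]
    define q :: "'a \<Rightarrow> real" where "q = (\<lambda>\<omega>. indicator C (W \<omega>))"
    have qM[measurable]: "q \<in> borel_measurable M" unfolding q_def by measurable
    have qint: "integrable M q"
      by (rule integrable_const_bound[of _ 1]) (auto simp: q_def indicator_def)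
    define p where "p = real_cond_exp M F q"
    have pF[measurable]: "p \<in> borel_measurable F" unfolding p_def by measurable
    have pM[measurable]: "p \<in> borel_measurable M" unfolding p_def by measurable
    have p01: "AE \<omega> in M. 0 \<le> p \<omega> \<and> p \<omega> \<le> 1"
    proof -
      have "AE \<omega> in M. 0 \<le> p \<omega>" unfolding p_def
        by (rule F.real_cond_exp_ge_c) (use qint in \<open>auto simp: q_def\<close>)
      moreover have "AE \<omega> in M. p \<omega> \<le> 1" unfolding p_def
        by (rule F.real_cond_exp_le_c) (use qint in \<open>auto simp: q_def indicator_def\<close>)
      ultimately show ?thesis by eventually_elim simp
    qed
    have bnd: "integrable M (\<lambda>\<omega>. p \<omega> * h \<omega>)" "integrable M (\<lambda>\<omega>. q \<omega> * h \<omega>)"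
      if h: "integrable M h" for h :: "'a \<Rightarrow> real"
    proof -
      have "AE \<omega> in M. norm (p \<omega> * h \<omega>) \<le> norm (h \<omega>)"
        using p01 by eventually_elim (auto simp: abs_mult intro!: mult_left_le_one_le)
      thus "integrable M (\<lambda>\<omega>. p \<omega> * h \<omega>)"
        using h by (intro Bochner_Integration.integrable_bound[OF h]) auto
      show "integrable M (\<lambda>\<omega>. q \<omega> * h \<omega>)"
        by (rule Bochner_Integration.integrable_bound[OF h])
           (use h in \<open>auto simp: q_def indicator_def\<close>)
    qed
    have indint: "integrable M (\<lambda>\<omega>. indicator D' \<omega> * h \<omega>)"
      if "D' \<in> sets F" "integrable M h" for h :: "'a \<Rightarrow> real" and D' :: "'a set"
      using integrable_mult_indicator[OF FM[OF that(1)] that(2)] by simp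
    \<comment> \<open>The roles are exchanged here: the residual of an indicator of \<open>W\<close>
      is tested against functions of \<open>U\<close>.\<close>
    have pq: "(\<integral>\<omega>. (indicator D \<omega> * (indicator A \<omega> * f (U \<omega>))) * (q \<omega> - p \<omega>) \<partial>M) = 0"
    proof (rule expectation_orthogonal_join_algebra[OF F U])
      show "integrable M (\<lambda>\<omega>. q \<omega> - p \<omega>)"
        using qint bnd(1)[of "\<lambda>_. 1"] by simp
      have sub: "subalgebra (join_algebra M F U) F" by (rule subalgebra_join_algebra_left[OF F U])
      have "(\<lambda>\<omega>. indicator D \<omega> * indicator A \<omega> :: real) \<in> borel_measurable (join_algebra M F U)"
        by (rule measurable_from_subalg[OF sub]) (use D A in measurable)
      moreover have "(\<lambda>\<omega>. f (U \<omega>)) \<in> borel_measurable (join_algebra M F U)"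
        using measurable_compose[OF measurable_join_algebra_right[OF F U] f] .
      ultimately show "(\<lambda>\<omega>. indicator D \<omega> * (indicator A \<omega> * f (U \<omega>))) \<in> borel_measurable (join_algebra M F U)"
        using borel_measurable_times by (simp add: mult.assoc[symmetric])
      have "integrable M (\<lambda>\<omega>. q \<omega> * (indicator D \<omega> * (indicator A \<omega> * f (U \<omega>)))
          - p \<omega> * (indicator D \<omega> * (indicator A \<omega> * f (U \<omega>))))"
        by (intro Bochner_Integration.integrable_diff bnd indint D int)
      thus "integrable M (\<lambda>\<omega>. indicator D \<omega> * (indicator A \<omega> * f (U \<omega>)) * (q \<omega> - p \<omega>))"
        by (simp add: algebra_simps)
      fix D' :: "'a set" and S :: "'b set" assume D': "D' \<in> sets F" and S[measurable]: "S \<in> sets borel"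
      note [measurable] = FM[OF D']
      let ?s = "\<lambda>\<omega>. indicator S (U \<omega>) :: real"
      have sint: "integrable M ?s"
        by (rule integrable_const_bound[of _ 1]) (auto simp: indicator_def)
      have "(\<integral>\<omega>. indicator D' \<omega> * (?s \<omega> * q \<omega>) \<partial>M)
          = (\<integral>\<omega>. indicator D' \<omega> * real_cond_exp M F (\<lambda>\<omega>. ?s \<omega> * q \<omega>) \<omega> \<partial>M)"
        by (rule F.real_cond_exp_intg(2)[symmetric])
           (use bnd(2)[OF sint] D' in \<open>auto intro!: indint simp: mult.commute\<close>)
      \<comment> \<open>Conditional independence enters here and factors the conditional
        expectation. As \<open>p\<close> is measurable in \<open>F\<close>, the conditioning on the
        remaining factor \<open>?s\<close> can then be undone.\<close>
      also have "\<dots> = (\<integral>\<omega>. (indicator D' \<omega> * p \<omega>) * real_cond_exp M F ?s \<omega> \<partial>M)"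
      proof (rule integral_cong_AE)
        have "AE \<omega> in M. real_cond_exp M F (\<lambda>\<omega>. ?s \<omega> * q \<omega>) \<omega> = real_cond_exp M F ?s \<omega> * p \<omega>"
          using ci S C unfolding cond_indep_var_def p_def q_def by blast
        thus "AE \<omega> in M. indicator D' \<omega> * real_cond_exp M F (\<lambda>\<omega>. ?s \<omega> * q \<omega>) \<omega>
            = (indicator D' \<omega> * p \<omega>) * real_cond_exp M F ?s \<omega>"
          by eventually_elim simp
      qed measurable
      also have "\<dots> = (\<integral>\<omega>. (indicator D' \<omega> * p \<omega>) * ?s \<omega> \<partial>M)"
        by (rule F.real_cond_exp_intg(2))
           (use indint[OF D' bnd(1)[OF sint]] D' in \<open>auto simp: mult.assoc\<close>)
      finally have eq: "(\<integral>\<omega>. indicator D' \<omega> * (?s \<omega> * q \<omega>) \<partial>M) = (\<integral>\<omega>. indicator D' \<omega> * (?s \<omega> * p \<omega>) \<partial>M)"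
        by (simp add: mult_ac)
      have "(\<integral>\<omega>. indicator D' \<omega> * (?s \<omega> * (q \<omega> - p \<omega>)) \<partial>M)
          = (\<integral>\<omega>. indicator D' \<omega> * (?s \<omega> * q \<omega>) - indicator D' \<omega> * (?s \<omega> * p \<omega>) \<partial>M)"
        by (simp add: algebra_simps)
      also have "\<dots> = 0"
        using eq bnd[OF sint] by (subst Bochner_Integration.integral_diff)
          (auto intro!: indint D' simp: mult.commute)
      finally show "(\<integral>\<omega>. indicator D' \<omega> * (indicator S (U \<omega>) * (q \<omega> - p \<omega>)) \<partial>M) = 0" .
    qed
    have iu: "integrable M (\<lambda>\<omega>. indicator D \<omega> * (indicator A \<omega> * f (U \<omega>)))"
      by (intro indint D int)
    have iv: "integrable M (\<lambda>\<omega>. indicator D \<omega> * (indicator A \<omega> * v \<omega>))"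
      by (intro indint D Av)
    have "(\<integral>\<omega>. q \<omega> * (indicator D \<omega> * (indicator A \<omega> * f (U \<omega>))) \<partial>M)
        = (\<integral>\<omega>. p \<omega> * (indicator D \<omega> * (indicator A \<omega> * f (U \<omega>))) \<partial>M)"
    proof -
      have "(\<integral>\<omega>. q \<omega> * (indicator D \<omega> * (indicator A \<omega> * f (U \<omega>)))
          - p \<omega> * (indicator D \<omega> * (indicator A \<omega> * f (U \<omega>))) \<partial>M) = 0"
        using pq by (simp add: algebra_simps)
      thus ?thesis by (subst (asm) Bochner_Integration.integral_diff) (auto intro!: bnd iu)
    qed
    \<comment> \<open>Since \<open>p\<close> is measurable in \<open>F\<close>,
      \<open>f (U \<omega>)\<close> may be exchanged for \<open>v\<close>; since \<open>v\<close> is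
      measurable in \<open>F\<close> too, \<open>p\<close> is then exchanged back for
      \<open>q\<close>.\<close>
    also have "\<dots> = (\<integral>\<omega>. (p \<omega> * (indicator D \<omega> * indicator A \<omega>)) * f (U \<omega>) \<partial>M)"
      by (simp add: mult_ac)
    also have "\<dots> = (\<integral>\<omega>. (p \<omega> * (indicator D \<omega> * indicator A \<omega>)) * real_cond_exp M F (\<lambda>\<omega>. f (U \<omega>)) \<omega> \<partial>M)"
    proof (rule F.real_cond_exp_intg(2)[symmetric])
      show "integrable M (\<lambda>\<omega>. (p \<omega> * (indicator D \<omega> * indicator A \<omega>)) * f (U \<omega>))"
        using bnd(1)[OF iu] by (simp add: mult_ac)
    qed (use D A in measurable)
    also have "\<dots> = (\<integral>\<omega>. (indicator D \<omega> * (indicator A \<omega> * v \<omega>)) * real_cond_exp M F q \<omega> \<partial>M)"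
      unfolding p_def[symmetric]
    proof (rule integral_cong_AE)
      show "AE \<omega> in M. (p \<omega> * (indicator D \<omega> * indicator A \<omega>)) * real_cond_exp M F (\<lambda>\<omega>. f (U \<omega>)) \<omega>
          = (indicator D \<omega> * (indicator A \<omega> * v \<omega>)) * p \<omega>"
        using v(2) by eventually_elim simp
    qed measurable
    also have "\<dots> = (\<integral>\<omega>. (indicator D \<omega> * (indicator A \<omega> * v \<omega>)) * q \<omega> \<partial>M)"
      by (rule F.real_cond_exp_intg(2))
         (use bnd(2)[OF iv] D A v(1) in \<open>auto simp: mult.commute\<close>)
    finally have "(\<integral>\<omega>. q \<omega> * (indicator D \<omega> * (indicator A \<omega> * f (U \<omega>))) \<partial>M)
        - (\<integral>\<omega>. q \<omega> * (indicator D \<omega> * (indicator A \<omega> * v \<omega>)) \<partial>M) = 0"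
      by (simp add: mult_ac)
    hence "(\<integral>\<omega>. q \<omega> * (indicator D \<omega> * (indicator A \<omega> * f (U \<omega>)))
        - q \<omega> * (indicator D \<omega> * (indicator A \<omega> * v \<omega>)) \<partial>M) = 0"
      by (subst Bochner_Integration.integral_diff) (auto intro!: bnd iu iv)
    thus "(\<integral>\<omega>. indicator D \<omega> * (indicator C (W \<omega>) * (indicator A \<omega> * (f (U \<omega>) - v \<omega>))) \<partial>M) = 0"
      by (simp add: q_def algebra_simps)
  qed
qed

section \<open>Almost supermartingales\<close>

text \<open>Doob's argument: the truncated process is stopped when it first reaches \<open>b\<close>
  from time \<open>n\<close> on. Truncation keeps every expectation finite and makes the stopped
  value exactly \<open>b\<close>, so the stopped expectation controls the crossing
  probability.\<close>

lemma (in prob_space) almost_supermartingale_maximal: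
  fixes V :: "nat \<Rightarrow> 'a \<Rightarrow> real"
  assumes sub: "\<And>k. subalgebra M (F k)"
    and adapted: "\<And>j k. j \<le> k \<Longrightarrow> V j \<in> borel_measurable (F k)"
    and nonneg: "\<And>k \<omega>. 0 \<le> V k \<omega>" and b: "b > 0"
    and step: "\<And>k A. A \<in> sets (F k) \<Longrightarrow>
      (\<integral>\<omega>. indicator A \<omega> * min (V (Suc k) \<omega>) b \<partial>M)
        \<le> (\<integral>\<omega>. indicator A \<omega> * min (V k \<omega>) b \<partial>M) + e k"
    and tail: "\<And>m. (\<Sum>k=n..<m. e k) \<le> \<kappa>"
  shows "b * prob {\<omega> \<in> space M. \<exists>k\<ge>n. b \<le> V k \<omega>} \<le> expectation (\<lambda>\<omega>. min (V n \<omega>) b) + \<kappa>"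
proof -
  have VM[measurable]: "V k \<in> borel_measurable M" for k
    using measurable_from_subalg[OF sub adapted[of k k]] by simp
  define U where "U = (\<lambda>m. {\<omega> \<in> space M. \<forall>k\<in>{n..m}. V k \<omega> < b})"
  have UF: "U m \<in> sets (F m)" for m
  proof -
    have "{\<omega> \<in> space (F m). \<forall>k\<in>{n..m}. V k \<omega> < b} \<in> sets (F m)"
      using adapted by (intro sets.sets_Collect_finite_All) (auto intro: borel_measurable_less)
    thus ?thesis using sub[of m] by (simp add: U_def subalgebra_def)
  qed
  have UM[measurable]: "U m \<in> sets M" for m using UF[of m] sub[of m] by (auto simp: subalgebra_def)
  have imin: "integrable M (\<lambda>\<omega>. indicator A \<omega> * min (V k \<omega>) b)" if [measurable]: "A \<in> sets M" for A k
    using nonneg b by (intro integrable_const_bound[of _ b]) (auto simp: indicator_def)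
  have iU: "integrable M (\<lambda>\<omega>. b * (1 - indicator (U m) \<omega>))" for m
  proof (rule integrable_mult_right)
    show "integrable M (\<lambda>\<omega>. 1 - indicator (U m) \<omega> :: real)"
      by (rule integrable_const_bound[of _ 1]) (auto simp: indicator_def)
  qed
  \<comment> \<open>The expectation of the stopped process at time \<open>m\<close>: outcomes
    outside \<open>U m\<close> have already crossed and are frozen at \<open>b\<close>.\<close>
  define \<psi> where "\<psi> = (\<lambda>m. \<integral>\<omega>. indicator (U m) \<omega> * min (V m \<omega>) b + b * (1 - indicator (U m) \<omega>) \<partial>M)"
  have \<psi>: "\<psi> m \<le> expectation (\<lambda>\<omega>. min (V n \<omega>) b) + (\<Sum>k=n..<m. e k)" if "n \<le> m" for m
    using that
  proof (induction m rule: dec_induct)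
    case base
    have "\<psi> n = expectation (\<lambda>\<omega>. min (V n \<omega>) b)"
      unfolding \<psi>_def by (rule Bochner_Integration.integral_cong) (auto simp: U_def indicator_def)
    thus ?case by simp
  next
    case (step m)
    \<comment> \<open>On outcomes that cross exactly at time \<open>Suc m\<close> the truncated
      value equals \<open>b\<close>, so \<open>U (Suc m)\<close> may be replaced by
      \<open>U m\<close>, an event known at time \<open>m\<close>.\<close>
    have "\<psi> (Suc m) = (\<integral>\<omega>. indicator (U m) \<omega> * min (V (Suc m) \<omega>) b + b * (1 - indicator (U m) \<omega>) \<partial>M)"
      unfolding \<psi>_def using step.hyps
      by (intro Bochner_Integration.integral_cong) (auto simp: U_def indicator_def atLeastAtMostSuc_conv)
    also have "\<dots> = (\<integral>\<omega>. indicator (U m) \<omega> * min (V (Suc m) \<omega>) b \<partial>M) + (\<integral>\<omega>. b * (1 - indicator (U m) \<omega>) \<partial>M)"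
      by (intro Bochner_Integration.integral_add imin iU UM)
    also have "\<dots> \<le> (\<integral>\<omega>. indicator (U m) \<omega> * min (V m \<omega>) b \<partial>M) + e m + (\<integral>\<omega>. b * (1 - indicator (U m) \<omega>) \<partial>M)"
      using assms(5)[OF UF[of m]] by simp
    also have "\<dots> = \<psi> m + e m"
      unfolding \<psi>_def by (simp only: Bochner_Integration.integral_add[OF imin[OF UM] iU])
    finally show ?case using step by simp
  qed
  have fin: "b * prob (space M - U m) \<le> expectation (\<lambda>\<omega>. min (V n \<omega>) b) + \<kappa>" if m: "n \<le> m" for m
  proof -
    have "b * prob (space M - U m) = (\<integral>\<omega>. b * indicator (space M - U m) \<omega> \<partial>M)" by simp
    also have "\<dots> \<le> \<psi> m" unfolding \<psi>_def
    proof (rule integral_mono)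
      show "integrable M (\<lambda>\<omega>. b * indicator (space M - U m) \<omega>)"
        using b by (intro integrable_const_bound[of _ b]) (auto simp: indicator_def)
      show "integrable M (\<lambda>\<omega>. indicator (U m) \<omega> * min (V m \<omega>) b + b * (1 - indicator (U m) \<omega>))"
        by (intro Bochner_Integration.integrable_add imin iU UM)
    qed (use nonneg b in \<open>auto simp: indicator_def\<close>)
    also have "\<dots> \<le> expectation (\<lambda>\<omega>. min (V n \<omega>) b) + \<kappa>" using \<psi>[OF m] tail[of m] by linarith
    finally show ?thesis .
  qed
  have "{\<omega> \<in> space M. \<exists>k\<ge>n. b \<le> V k \<omega>} = (\<Union>m. space M - U (n + m))"
  proof (intro equalityI subsetI)
    fix \<omega> assume "\<omega> \<in> {\<omega> \<in> space M. \<exists>k\<ge>n. b \<le> V k \<omega>}"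
    then obtain k where "\<omega> \<in> space M" "n \<le> k" "b \<le> V k \<omega>" by auto
    hence "\<omega> \<in> space M - U (n + (k - n))" by (auto simp: U_def not_less)
    thus "\<omega> \<in> (\<Union>m. space M - U (n + m))" by blast
  qed (auto simp: U_def not_less)
  moreover have "(\<lambda>m. prob (space M - U (n + m))) \<longlonglongrightarrow> prob (\<Union>m. space M - U (n + m))"
    by (rule finite_Lim_measure_incseq) (auto simp: incseq_def U_def)
  ultimately have "(\<lambda>m. b * prob (space M - U (n + m))) \<longlonglongrightarrow> b * prob {\<omega> \<in> space M. \<exists>k\<ge>n. b \<le> V k \<omega>}"
    by (auto intro: tendsto_mult_left)
  thus ?thesis by (rule LIMSEQ_le_const2) (use fin in auto)
qed

text \<open>\<open>X\<close> may have infinite expectation, but the quotient is bounded by 1 and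
  dominated convergence applies. This is how the maximal inequality yields small probabilities at
  high levels.\<close>

lemma (in prob_space) expectation_min_over_bound_tendsto_zero:
  fixes X :: "'a \<Rightarrow> real"
  assumes [measurable]: "X \<in> borel_measurable M" and nonneg: "\<And>\<omega>. 0 \<le> X \<omega>"
  shows "(\<lambda>m. expectation (\<lambda>\<omega>. min (X \<omega>) (real (Suc m)) / real (Suc m))) \<longlonglongrightarrow> 0"
proof -
  have "(\<lambda>m. expectation (\<lambda>\<omega>. min (X \<omega>) (real (Suc m)) / real (Suc m))) \<longlonglongrightarrow> expectation (\<lambda>_. 0)"
  proof (rule integral_dominated_convergence[where w = "\<lambda>_. 1"])
    have "(\<lambda>m. min (X \<omega>) (real (Suc m)) / real (Suc m)) \<longlonglongrightarrow> 0" for \<omega>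
    proof (rule tendsto_sandwich[of "\<lambda>_. 0" _ _ "\<lambda>m. X \<omega> / real (Suc m)"])
      have "(\<lambda>m. X \<omega> * inverse (real (Suc m))) \<longlonglongrightarrow> X \<omega> * 0"
        by (intro tendsto_mult_left LIMSEQ_inverse_real_of_nat)
      thus "(\<lambda>m. X \<omega> / real (Suc m)) \<longlonglongrightarrow> 0" by (simp add: divide_inverse)
    qed (use nonneg in \<open>auto intro!: always_eventually divide_right_mono\<close>)
    thus "AE \<omega> in M. (\<lambda>m. min (X \<omega>) (real (Suc m)) / real (Suc m)) \<longlonglongrightarrow> 0" by simp
  qed (use nonneg in \<open>auto simp: divide_le_eq_1\<close>)
  thus ?thesis by simp
qed

text \<open>The error may grow with the level like \<open>1 + b\<close>: divided by a high level
  this factor stays bounded, and at a low level it is close to 1. Hence one sequence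
  \<open>e\<close> serves both uses of the maximal inequality.\<close>

lemma (in prob_space) almost_supermartingale_AE_tendsto_zero:
  fixes V :: "nat \<Rightarrow> 'a \<Rightarrow> real"
  assumes sub: "\<And>k. subalgebra M (F k)"
    and adapted: "\<And>j k. j \<le> k \<Longrightarrow> V j \<in> borel_measurable (F k)"
    and nonneg: "\<And>k \<omega>. 0 \<le> V k \<omega>"
    and e: "\<And>k. 0 \<le> e k" "summable e"
    and a: "\<And>k. 0 \<le> a k" "filterlim (\<lambda>n. \<Sum>k<n. a k) at_top sequentially"
    and step: "\<And>k b A. b > 0 \<Longrightarrow> A \<in> sets (F k) \<Longrightarrow>
      (\<integral>\<omega>. indicator A \<omega> * min (V (Suc k) \<omega>) b \<partial>M)
        \<le> (\<integral>\<omega>. indicator A \<omega> * min (V k \<omega>) b \<partial>M)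
          - a k * (\<integral>\<omega>. indicator A \<omega> * (indicator {..<b} (V k \<omega>) * V k \<omega>) \<partial>M) + (1 + b) * e k"
  shows "AE \<omega> in M. (\<lambda>k. V k \<omega>) \<longlonglongrightarrow> 0"
proof -
  have VM[measurable]: "V k \<in> borel_measurable M" for k
    using measurable_from_subalg[OF sub adapted[of k k]] by simp
  define q where "q = (\<lambda>b k. expectation (\<lambda>\<omega>. indicator {..<b} (V k \<omega>) * V k \<omega>))"
  have spF: "space M \<in> sets (F k)" for k using sub[of k] sets.top[of "F k"] by (simp add: subalgebra_def)
  have maximal: "b * prob {\<omega> \<in> space M. \<exists>k\<ge>n. b \<le> V k \<omega>}
      \<le> expectation (\<lambda>\<omega>. min (V n \<omega>) b) + (1 + b) * \<kappa>"
    if b: "b > 0" and tail: "\<And>m. (\<Sum>k=n..<m. e k) \<le> \<kappa>" for b n \<kappa>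
  proof (rule almost_supermartingale_maximal[where F = F and e = "\<lambda>k. (1 + b) * e k"])
    fix k A assume A: "A \<in> sets (F k)"
    have "0 \<le> a k * (\<integral>\<omega>. indicator A \<omega> * (indicator {..<b} (V k \<omega>) * V k \<omega>) \<partial>M)"
      using a(1) nonneg by (intro mult_nonneg_nonneg Bochner_Integration.integral_nonneg) auto
    thus "(\<integral>\<omega>. indicator A \<omega> * min (V (Suc k) \<omega>) b \<partial>M)
        \<le> (\<integral>\<omega>. indicator A \<omega> * min (V k \<omega>) b \<partial>M) + (1 + b) * e k"
      using step[OF b A] by linarith
  next
    show "(\<Sum>k=n..<m. (1 + b) * e k) \<le> (1 + b) * \<kappa>" for m
      using tail[of m] b by (simp flip: sum_distrib_left)
  qed (use sub adapted nonneg b in auto)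
  have tail: "\<exists>N. \<forall>n\<ge>N. \<forall>m. (\<Sum>k=n..<m. e k) \<le> \<kappa>" if \<kappa>: "\<kappa> > 0" for \<kappa>
  proof -
    obtain N where "\<forall>n\<ge>N. \<forall>m. norm (\<Sum>k=n..<m. e k) < \<kappa>"
      using e(2)[unfolded summable_Cauchy] \<kappa> by meson
    thus ?thesis by (intro exI[of _ N]) (auto simp: abs_less_iff less_imp_le)
  qed
  \<comment> \<open>Level and starting time are chosen so that, relative to \<open>b\<close>, the
    truncated start contributes at most half of \<epsilon>. The error tail contributes the other
    half, as \<open>1 + b \<le> 2 * b\<close> when \<open>b \<ge> 1\<close>.\<close>
  have bounded: "\<exists>n b. b > 0 \<and> prob {\<omega> \<in> space M. \<exists>k\<ge>n. b \<le> V k \<omega>} \<le> \<epsilon>" if \<epsilon>: "\<epsilon> > 0" for \<epsilon>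
  proof -
    obtain n where n: "\<And>m. (\<Sum>k=n..<m. e k) \<le> \<epsilon> / 4" using tail[of "\<epsilon> / 4"] \<epsilon> by auto
    have "eventually (\<lambda>m. expectation (\<lambda>\<omega>. min (V n \<omega>) (real (Suc m)) / real (Suc m)) < \<epsilon> / 2) sequentially"
      using expectation_min_over_bound_tendsto_zero[OF VM nonneg] \<epsilon> by (intro order_tendstoD) auto
    then obtain m where m: "expectation (\<lambda>\<omega>. min (V n \<omega>) (real (Suc m)) / real (Suc m)) < \<epsilon> / 2"
      by (auto simp: eventually_sequentially)
    define b where "b = real (Suc m)"
    have b: "b \<ge> 1" by (simp add: b_def)
    have "b * prob {\<omega> \<in> space M. \<exists>k\<ge>n. b \<le> V k \<omega>} \<le> expectation (\<lambda>\<omega>. min (V n \<omega>) b) + (1 + b) * (\<epsilon> / 4)"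
      using b n by (intro maximal) auto
    also have "expectation (\<lambda>\<omega>. min (V n \<omega>) b) \<le> b * (\<epsilon> / 2)"
      using m b unfolding b_def[symmetric] by (simp add: field_simps)
    also have "(1 + b) * (\<epsilon> / 4) \<le> b * (\<epsilon> / 2)" using b \<epsilon> by (simp add: field_simps)
    finally have "b * prob {\<omega> \<in> space M. \<exists>k\<ge>n. b \<le> V k \<omega>} \<le> b * \<epsilon>" by (simp add: mult.commute)
    thus ?thesis using b by (intro exI[of _ n] exI[of _ b]) auto
  qed
  \<comment> \<open>Otherwise the drift terms would sum to infinity, because the sums of
    \<open>a\<close> diverge, while telescoping bounds them by the initial truncated expectation
    plus the total error.\<close>
  have small: "\<exists>k\<ge>n. q b k < \<epsilon>" if \<epsilon>: "\<epsilon> > 0" and b: "b > 0" for n b \<epsilon>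
  proof (rule ccontr)
    assume "\<not> ?thesis"
    hence large: "\<epsilon> \<le> q b k" if "k \<ge> n" for k using that by (auto simp: not_less)
    have q0: "0 \<le> q b k" for k unfolding q_def using nonneg by (intro Bochner_Integration.integral_nonneg) auto
    have tel: "expectation (\<lambda>\<omega>. min (V m \<omega>) b) + (\<Sum>k<m. a k * q b k)
        \<le> expectation (\<lambda>\<omega>. min (V 0 \<omega>) b) + (1 + b) * (\<Sum>k<m. e k)" for m
    proof (induction m)
      case (Suc m)
      have eq: "(\<integral>\<omega>. indicator (space M) \<omega> * h \<omega> \<partial>M) = expectation h" for h :: "'a \<Rightarrow> real"
        by (rule Bochner_Integration.integral_cong) auto
      have "expectation (\<lambda>\<omega>. min (V (Suc m) \<omega>) b)
          \<le> expectation (\<lambda>\<omega>. min (V m \<omega>) b) - a m * q b m + (1 + b) * e m"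
        using step[OF b spF] unfolding eq q_def .
      thus ?case using Suc by (simp add: algebra_simps)
    qed simp
    have pos: "0 \<le> expectation (\<lambda>\<omega>. min (V m \<omega>) b)" for m
      using nonneg b by (intro Bochner_Integration.integral_nonneg) auto
    define K where "K = expectation (\<lambda>\<omega>. min (V 0 \<omega>) b) + (1 + b) * suminf e"
    have "(\<Sum>k<m. a k * q b k) \<le> K" for m
    proof -
      have "(1 + b) * (\<Sum>k<m. e k) \<le> (1 + b) * suminf e"
        using b e by (intro mult_left_mono sum_le_suminf) auto
      thus ?thesis using tel[of m] pos[of m] unfolding K_def by linarith
    qed
    moreover have "\<epsilon> * ((\<Sum>k<m. a k) - (\<Sum>k<n. a k)) \<le> (\<Sum>k<m. a k * q b k)" if m: "m \<ge> n" for m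
    proof -
      have "\<epsilon> * ((\<Sum>k<m. a k) - (\<Sum>k<n. a k)) = (\<Sum>k=n..<m. a k * \<epsilon>)"
        using sum_diff_nat_ivl[of 0 n m a] m
        by (simp add: atLeast0LessThan sum_distrib_left mult.commute flip: sum_distrib_right)
      also have "\<dots> \<le> (\<Sum>k=n..<m. a k * q b k)"
        using a(1) large by (intro sum_mono mult_left_mono) auto
      also have "\<dots> \<le> (\<Sum>k<m. a k * q b k)"
        using a(1) q0 by (intro sum_mono2) auto
      finally show ?thesis .
    qed
    ultimately have bound: "(\<Sum>k<m. a k) \<le> K / \<epsilon> + (\<Sum>k<n. a k)" if "m \<ge> n" for m
    proof -
      have "\<epsilon> * ((\<Sum>k<m. a k) - (\<Sum>k<n. a k)) \<le> K"
        using \<open>\<And>m. (\<Sum>k<m. a k * q b k) \<le> K\<close>[of m]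
          \<open>\<And>m. m \<ge> n \<Longrightarrow> \<epsilon> * ((\<Sum>k<m. a k) - (\<Sum>k<n. a k)) \<le> (\<Sum>k<m. a k * q b k)\<close>[OF that] by linarith
      thus ?thesis using \<epsilon> by (simp add: field_simps)
    qed
    have "eventually (\<lambda>m. K / \<epsilon> + (\<Sum>k<n. a k) < (\<Sum>k<m. a k)) sequentially"
      using a(2) by (auto simp: filterlim_at_top_dense)
    then obtain m where "m \<ge> n" "K / \<epsilon> + (\<Sum>k<n. a k) < (\<Sum>k<m. a k)"
      unfolding eventually_sequentially by (meson nle_le)
    thus False using bound[of m] by linarith
  qed
  have exceed: "prob {\<omega> \<in> space M. \<forall>k. \<exists>j\<ge>k. r \<le> V j \<omega>} \<le> \<epsilon>" if r: "r > 0" and \<epsilon>: "\<epsilon> > 0" for r \<epsilon>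
  proof -
    obtain n b where b: "b > 0" and nb: "prob {\<omega> \<in> space M. \<exists>k\<ge>n. b \<le> V k \<omega>} \<le> \<epsilon> / 3"
      using bounded[of "\<epsilon> / 3"] \<epsilon> by auto
    \<comment> \<open>Chosen so that the error \<open>(1 + r) * \<kappa>\<close> at the low level
      \<open>r\<close> is one third of \<open>\<epsilon> * r\<close>. The other thirds come from
      \<open>q b k\<close> and from the outcomes that exceed the high level
      \<open>b\<close>.\<close>
    define \<kappa> where "\<kappa> = (\<epsilon> / 3) * r / (1 + r)"
    have "\<kappa> > 0" using r \<epsilon> by (simp add: \<kappa>_def)
    then obtain N where N: "\<And>k m. k \<ge> N \<Longrightarrow> (\<Sum>i=k..<m. e i) \<le> \<kappa>" using tail by blast
    obtain k where k: "k \<ge> max n N" and qk: "q b k < (\<epsilon> / 3) * r"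
      using small[of "(\<epsilon> / 3) * r" b "max n N"] r b \<epsilon> by auto
    have "r * prob {\<omega> \<in> space M. \<exists>j\<ge>k. r \<le> V j \<omega>} \<le> expectation (\<lambda>\<omega>. min (V k \<omega>) r) + (1 + r) * \<kappa>"
      using k N r by (intro maximal) auto
    also have "(1 + r) * \<kappa> = (\<epsilon> / 3) * r"
      using r unfolding \<kappa>_def times_divide_eq_right by (intro nonzero_mult_div_cancel_left) auto
    \<comment> \<open>Where \<open>V k\<close> is below \<open>b\<close> the minimum is at most
      \<open>V k\<close>; elsewhere it is at most \<open>r\<close>, and the outcome lies in the
      exceedance event because \<open>k \<ge> n\<close>.\<close>
    also have "expectation (\<lambda>\<omega>. min (V k \<omega>) r)
        \<le> expectation (\<lambda>\<omega>. indicator {..<b} (V k \<omega>) * V k \<omega> + r * indicator {\<omega> \<in> space M. \<exists>k\<ge>n. b \<le> V k \<omega>} \<omega>)"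
    proof (rule integral_mono)
      show "integrable M (\<lambda>\<omega>. min (V k \<omega>) r)"
        using nonneg r by (intro integrable_const_bound[of _ r]) auto
      show "integrable M (\<lambda>\<omega>. indicator {..<b} (V k \<omega>) * V k \<omega> + r * indicator {\<omega> \<in> space M. \<exists>k\<ge>n. b \<le> V k \<omega>} \<omega>)"
        using nonneg r b by (intro integrable_const_bound[of _ "b + r"]) (auto simp: indicator_def add_increasing2)
    qed (use nonneg r k in \<open>auto simp: indicator_def\<close>)
    also have "\<dots> = q b k + r * prob {\<omega> \<in> space M. \<exists>k\<ge>n. b \<le> V k \<omega>}"
    proof -
      have "integrable M (\<lambda>\<omega>. indicator {..<b} (V k \<omega>) * V k \<omega>)"
        using nonneg b by (intro integrable_const_bound[of _ b]) (auto simp: indicator_def)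
      moreover have "integrable M (\<lambda>\<omega>. r * indicator {\<omega> \<in> space M. \<exists>k\<ge>n. b \<le> V k \<omega>} \<omega>)"
        using r by (intro integrable_const_bound[of _ r]) (auto simp: indicator_def)
      ultimately show ?thesis unfolding q_def
        by (subst Bochner_Integration.integral_add) auto
    qed
    also have "\<dots> \<le> (\<epsilon> / 3) * r + r * (\<epsilon> / 3)"
      using qk nb r by (intro add_mono mult_left_mono) auto
    finally have "r * prob {\<omega> \<in> space M. \<exists>j\<ge>k. r \<le> V j \<omega>} \<le> r * \<epsilon>" by (simp add: field_simps)
    hence "prob {\<omega> \<in> space M. \<exists>j\<ge>k. r \<le> V j \<omega>} \<le> \<epsilon>" using r by simp
    moreover have "prob {\<omega> \<in> space M. \<forall>k. \<exists>j\<ge>k. r \<le> V j \<omega>} \<le> prob {\<omega> \<in> space M. \<exists>j\<ge>k. r \<le> V j \<omega>}"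
      by (intro finite_measure_mono) auto
    ultimately show ?thesis by linarith
  qed
  have "AE \<omega> in M. \<not> (\<forall>k. \<exists>j\<ge>k. r \<le> V j \<omega>)" if r: "r > 0" for r
  proof -
    have "prob {\<omega> \<in> space M. \<forall>k. \<exists>j\<ge>k. r \<le> V j \<omega>} \<le> 0"
      using exceed[OF r] by (rule field_le_epsilon[of _ 0, simplified])
    hence "prob {\<omega> \<in> space M. \<forall>k. \<exists>j\<ge>k. r \<le> V j \<omega>} = 0"
      using measure_nonneg[of M] by (auto intro: antisym)
    hence "{\<omega> \<in> space M. \<forall>k. \<exists>j\<ge>k. r \<le> V j \<omega>} \<in> null_sets M"
      by (intro null_setsI) (auto simp: emeasure_eq_measure)
    thus ?thesis by (rule AE_I') auto
  qed
  hence "AE \<omega> in M. \<forall>m. \<not> (\<forall>k. \<exists>j\<ge>k. inverse (real (Suc m)) \<le> V j \<omega>)"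
    unfolding AE_all_countable by (simp del: of_nat_Suc)
  thus ?thesis
  proof eventually_elim
    case (elim \<omega>)
    show ?case
    proof (rule LIMSEQ_I)
      fix r :: real assume "r > 0"
      then obtain m where m: "inverse (real (Suc m)) < r" using reals_Archimedean by blast
      obtain k where k: "\<forall>j\<ge>k. V j \<omega> < inverse (real (Suc m))"
        using elim[THEN spec, of m] by (meson not_le)
      have "norm (V j \<omega> - 0) < r" if "j \<ge> k" for j
        using k that m nonneg[of j \<omega>] by fastforce
      thus "\<exists>no. \<forall>n\<ge>no. norm (V n \<omega> - 0) < r" by blast
    qed
  qed
qed

section \<open>Uniform sampling and the line-search phase\<close>

text \<open>Double counting: every index lies in equally many subsets of size \<open>s\<close>, so
  the subset sums add up to a positive multiple of the full sum.\<close>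

lemma sum_nonpos_if_subset_sums_nonpos:
  fixes a :: "'i \<Rightarrow> real"
  assumes I: "finite I" and s: "1 \<le> s" "s \<le> card I"
    and S: "\<And>S. S \<subseteq> I \<Longrightarrow> card S = s \<Longrightarrow> sum a S \<le> 0"
  shows "sum a I \<le> 0"
proof -
  define \<S> where "\<S> = {S. S \<subseteq> I \<and> card S = s}"
  have fin: "finite \<S>" using I by (simp add: \<S>_def)
  have count: "card {S \<in> \<S>. i \<in> S} = (card I - 1) choose (s - 1)" if i: "i \<in> I" for i
  proof -
    have "{S \<in> \<S>. i \<in> S} = insert i ` {T. T \<subseteq> I - {i} \<and> card T = s - 1}"
    proof (intro equalityI subsetI)
      fix S assume S: "S \<in> {S \<in> \<S>. i \<in> S}"
      hence "S = insert i (S - {i})" by auto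
      moreover have "S - {i} \<subseteq> I - {i}" "card (S - {i}) = s - 1"
        using S by (auto simp: \<S>_def)
      ultimately show "S \<in> insert i ` {T. T \<subseteq> I - {i} \<and> card T = s - 1}" by blast
    next
      fix S assume "S \<in> insert i ` {T. T \<subseteq> I - {i} \<and> card T = s - 1}"
      then obtain T where T: "S = insert i T" "T \<subseteq> I - {i}" "card T = s - 1" by blast
      have "finite T" using T(2) I by (meson finite_Diff finite_subset)
      moreover have "i \<notin> T" using T(2) by blast
      ultimately show "S \<in> {S \<in> \<S>. i \<in> S}" using T i s by (auto simp: \<S>_def)
    qed
    moreover have "inj_on (insert i) {T. T \<subseteq> I - {i} \<and> card T = s - 1}"
    proof (rule inj_onI)
      fix S T assume "S \<in> {T. T \<subseteq> I - {i} \<and> card T = s - 1}" "T \<in> {T. T \<subseteq> I - {i} \<and> card T = s - 1}"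
      hence "S = insert i S - {i}" "T = insert i T - {i}" by auto
      moreover assume "insert i S = insert i T"
      ultimately show "S = T" by simp
    qed
    ultimately show ?thesis using I i by (simp add: card_image n_subsets)
  qed
  have "(\<Sum>S\<in>\<S>. sum a S) = (\<Sum>S\<in>\<S>. \<Sum>i\<in>{i\<in>I. i \<in> S}. a i)"
    by (intro sum.cong) (auto simp: \<S>_def intro: arg_cong[where f = "sum a"])
  also have "\<dots> = (\<Sum>i\<in>I. \<Sum>S\<in>{S\<in>\<S>. i \<in> S}. a i)"
    by (rule sum.swap_restrict[OF fin I])
  also have "\<dots> = real ((card I - 1) choose (s - 1)) * sum a I"
    by (simp add: count sum_distrib_left)
  finally have "real ((card I - 1) choose (s - 1)) * sum a I \<le> 0"
    using sum_nonpos[of \<S> "sum a"] S by (simp add: \<S>_def)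
  moreover have "real ((card I - 1) choose (s - 1)) > 0" using s by (simp add: zero_less_binomial)
  ultimately show ?thesis by (simp add: mult_le_0_iff)
qed

text \<open>\<open>A S\<close> is the event that \<open>S\<close> would be a bad sample, decided
  before the draw. On \<open>Z\<close> some set of the drawn size is bad. A union bound over sets,
  uniformity at the price \<open>N choose card S\<close>, and disjointness of the events
  \<open>D \<omega> = S\<close> compare this with the drawn sample being bad. The crude factor
  \<open>2 ^ N\<close> covers all sizes at once, as the size may be random.\<close>

lemma (in prob_space) prob_le_uniform_sample:
  assumes D: "uniform_sample M G E N D" and E: "E \<in> events"
    and A: "\<And>S. S \<subseteq> {1..N} \<Longrightarrow> A S \<in> sets G" and G: "sets G \<subseteq> events"
    and Z: "Z \<in> events" "\<And>\<omega>. \<omega> \<in> Z \<Longrightarrow> \<omega> \<in> E \<and> (\<exists>S\<subseteq>{1..N}. card S = card (D \<omega>) \<and> \<omega> \<in> A S)"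
  shows "prob Z \<le> 2 ^ N * prob {\<omega> \<in> E. \<omega> \<in> A (D \<omega>)}"
proof -
  have DM[measurable]: "D \<in> measurable M (count_space (Pow {1..N}))"
    and unif: "\<And>S. S \<subseteq> {1..N} \<Longrightarrow> prob {\<omega> \<in> A S \<inter> E. D \<omega> = S}
      = prob {\<omega> \<in> A S \<inter> E. card (D \<omega>) = card S} / real (N choose card S)"
    using D A unfolding uniform_sample_def by auto
  have AE: "A S \<inter> E \<in> events" if "S \<subseteq> {1..N}" for S using A[OF that] G E by auto
  have sp: "\<omega> \<in> space M" if "\<omega> \<in> E" for \<omega> using sets.sets_into_space[OF E] that by blast
  have Dsub: "D \<omega> \<subseteq> {1..N}" if "\<omega> \<in> space M" for \<omega>
    using measurable_space[OF DM that] by simp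
  have ev: "{\<omega> \<in> X. P (D \<omega>)} \<in> events" if X: "X \<in> events" for X P
  proof -
    have "D -` {S \<in> Pow {1..N}. P S} \<inter> space M \<in> events"
      by (rule measurable_sets[OF DM]) auto
    moreover have "{\<omega> \<in> X. P (D \<omega>)} = X \<inter> (D -` {S \<in> Pow {1..N}. P S} \<inter> space M)"
      using sets.sets_into_space[OF X] Dsub by auto
    ultimately show ?thesis using X by auto
  qed
  have binom: "real (N choose card S) \<le> 2 ^ N" "0 < real (N choose card S)" if "S \<subseteq> {1..N}" for S
  proof -
    have c: "card S \<le> N" using card_mono[OF _ that] by simp
    have "(N choose card S) \<le> (\<Sum>k\<le>N. N choose k)"
      by (rule member_le_sum) (use c in auto)
    thus "real (N choose card S) \<le> 2 ^ N"
      unfolding choose_row_sum by (metis of_nat_le_iff of_nat_numeral of_nat_power)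
    show "0 < real (N choose card S)" using c by (simp add: zero_less_binomial)
  qed
  have "prob Z \<le> prob (\<Union>S\<in>Pow {1..N}. {\<omega> \<in> A S \<inter> E. card (D \<omega>) = card S})"
  proof (rule finite_measure_mono)
    show "Z \<subseteq> (\<Union>S\<in>Pow {1..N}. {\<omega> \<in> A S \<inter> E. card (D \<omega>) = card S})"
    proof
      fix \<omega> assume "\<omega> \<in> Z"
      then obtain S where "S \<subseteq> {1..N}" "card S = card (D \<omega>)" "\<omega> \<in> A S" "\<omega> \<in> E"
        using Z(2) by blast
      thus "\<omega> \<in> (\<Union>S\<in>Pow {1..N}. {\<omega> \<in> A S \<inter> E. card (D \<omega>) = card S})"
        by (intro UN_I[of S]) auto
    qed
    show "(\<Union>S\<in>Pow {1..N}. {\<omega> \<in> A S \<inter> E. card (D \<omega>) = card S}) \<in> events"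
      using ev[OF AE] by (intro sets.finite_UN) auto
  qed
  also have "\<dots> \<le> (\<Sum>S\<in>Pow {1..N}. prob {\<omega> \<in> A S \<inter> E. card (D \<omega>) = card S})"
    using ev[OF AE] by (intro finite_measure_subadditive_finite) auto
  also have "\<dots> = (\<Sum>S\<in>Pow {1..N}. real (N choose card S) * prob {\<omega> \<in> A S \<inter> E. D \<omega> = S})"
  proof (rule sum.cong)
    fix S assume "S \<in> Pow {1..N}"
    hence S: "S \<subseteq> {1..N}" by simp
    show "prob {\<omega> \<in> A S \<inter> E. card (D \<omega>) = card S}
        = real (N choose card S) * prob {\<omega> \<in> A S \<inter> E. D \<omega> = S}"
      unfolding unif[OF S] using binom(2)[OF S] by simp
  qed simp
  also have "\<dots> \<le> (\<Sum>S\<in>Pow {1..N}. 2 ^ N * prob {\<omega> \<in> A S \<inter> E. D \<omega> = S})"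
    using binom by (intro sum_mono mult_right_mono) auto
  also have "\<dots> = 2 ^ N * prob (\<Union>S\<in>Pow {1..N}. {\<omega> \<in> A S \<inter> E. D \<omega> = S})"
    using ev[OF AE]
    by (subst finite_measure_finite_Union) (auto simp: sum_distrib_left disjoint_family_on_def)
  also have "(\<Union>S\<in>Pow {1..N}. {\<omega> \<in> A S \<inter> E. D \<omega> = S}) = {\<omega> \<in> E. \<omega> \<in> A (D \<omega>)}"
    using Dsub sp by blast
  finally show ?thesis .
qed

lemma measurable_sigma_preimages:
  assumes "X \<in> measurable M S" "preimages M S X \<subseteq> \<G>" "\<G> \<subseteq> Pow (space M)"
  shows "X \<in> measurable (sigma (space M) \<G>) S"
proof (rule measurableI)
  fix C assume "C \<in> sets S"
  hence "X -` C \<inter> space M \<in> \<G>" using assms(2) by (auto simp: preimages_def)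
  thus "X -` C \<inter> space (sigma (space M) \<G>) \<in> sets (sigma (space M) \<G>)"
    using assms(3) by (simp add: space_measure_of_conv)
qed (use assms measurable_space in \<open>auto simp: space_measure_of_conv\<close>)

lemma preimages_subset_sets: "X \<in> measurable M S \<Longrightarrow> preimages M S X \<subseteq> sets M"
  by (auto simp: preimages_def)

lemma subalgebra_sigma: "\<G> \<subseteq> sets M \<Longrightarrow> subalgebra M (sigma (space M) \<G>)"
  using sets.space_closed[of M]
  by (auto simp: subalgebra_def sets_measure_of_conv space_measure_of_conv
      intro: sets.sigma_sets_subset[THEN subsetD])

text \<open>Convexity of the squared norm enters through its tangent at the full gradient, which is
  linear in the sample gradient and therefore averages exactly.\<close>

lemma sample_decrease_full_if_all_of_size:
  assumes N: "1 \<le> s" "s \<le> N" and c: "cmin > 0"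
    and all: "\<And>S. S \<subseteq> {1..N} \<Longrightarrow> card S = s \<Longrightarrow> sample_decrease \<phi>i S cmin Cmax \<zeta> x xbar"
  shows "sample_decrease \<phi>i {1..N} cmin Cmax \<zeta> x xbar"
proof -
  define G where "G = avg_grad \<phi>i {1..N} x"
  define a where "a = (\<lambda>i. \<phi>i i xbar - \<phi>i i x
      + cmin * (2 * (G \<bullet> gradient (\<phi>i i) x) - G \<bullet> G) - Cmax * \<zeta>)"
  have suma: "sum a S = card S * (avg \<phi>i S xbar - avg \<phi>i S x
      + cmin * (2 * (G \<bullet> avg_grad \<phi>i S x) - G \<bullet> G) - Cmax * \<zeta>)" if "card S > 0" for S
    using that unfolding a_def avg_def avg_grad_def
    by (simp add: sum.distrib sum_subtractf inner_sum_right field_simps flip: sum_distrib_left)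
  have "sum a {1..N} \<le> 0"
  proof (rule sum_nonpos_if_subset_sums_nonpos[of _ s])
    fix S :: "nat set" assume S: "S \<subseteq> {1..N}" "card S = s"
    let ?g = "avg_grad \<phi>i S x"
    have "0 \<le> (norm (?g - G))\<^sup>2" by simp
    also have "\<dots> = (norm ?g)\<^sup>2 - (2 * (G \<bullet> ?g) - G \<bullet> G)"
      unfolding power2_norm_eq_inner by (simp add: inner_diff_left inner_diff_right inner_commute)
    finally have "cmin * (2 * (G \<bullet> ?g) - G \<bullet> G) \<le> cmin * (norm ?g)\<^sup>2"
      using c by (intro mult_left_mono) auto
    with all[OF S] have "avg \<phi>i S xbar - avg \<phi>i S x
      + cmin * (2 * (G \<bullet> ?g) - G \<bullet> G) - Cmax * \<zeta> \<le> 0"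
      unfolding sample_decrease_def by linarith
    thus "sum a S \<le> 0" using suma[of S] S N by (simp add: mult_nonneg_nonpos)
  qed (use N in auto)
  hence "real N * (avg \<phi>i {1..N} xbar - avg \<phi>i {1..N} x
      + cmin * (2 * (G \<bullet> G) - G \<bullet> G) - Cmax * \<zeta>) \<le> 0"
    using suma[of "{1..N}"] N by (simp add: G_def)
  hence "avg \<phi>i {1..N} xbar - avg \<phi>i {1..N} x + cmin * (G \<bullet> G) - Cmax * \<zeta> \<le> 0"
    using N by (simp add: mult_le_0_iff)
  thus ?thesis unfolding sample_decrease_def power2_norm_eq_inner G_def by linarith
qed

section \<open>Measurability of sample averages, of the acceptance test and of the line-search
  step\<close>

lemma borel_measurable_avg_sample:
  fixes h :: "'a \<Rightarrow> 'b::topological_space"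
  assumes S: "S \<in> measurable Q (count_space (Pow {1..N}))" and h: "h \<in> borel_measurable Q"
    and cont: "\<And>i. i \<in> {1..N} \<Longrightarrow> continuous_on UNIV (\<phi>i i)"
  shows "(\<lambda>\<omega>. avg \<phi>i (S \<omega>) (h \<omega>)) \<in> borel_measurable Q"
proof (rule measurable_compose_countable'[OF _ S])
  fix T assume T: "T \<in> Pow {1..N}"
  have "(\<lambda>\<omega>. \<phi>i i (h \<omega>)) \<in> borel_measurable Q" if "i \<in> T" for i
    using cont T that by (intro borel_measurable_continuous_on[OF _ h]) auto
  thus "(\<lambda>\<omega>. avg \<phi>i T (h \<omega>)) \<in> borel_measurable Q"
    unfolding avg_def by (intro borel_measurable_divide borel_measurable_sum) auto
qed (auto intro: countable_finite)

lemma borel_measurable_avg_grad_sample: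
  fixes h :: "'a \<Rightarrow> 'b::{real_inner, second_countable_topology}"
  assumes S: "S \<in> measurable Q (count_space (Pow {1..N}))" and h: "h \<in> borel_measurable Q"
    and cont: "\<And>i. i \<in> {1..N} \<Longrightarrow> continuous_on UNIV (gradient (\<phi>i i))"
  shows "(\<lambda>\<omega>. avg_grad \<phi>i (S \<omega>) (h \<omega>)) \<in> borel_measurable Q"
proof (rule measurable_compose_countable'[OF _ S])
  fix T assume T: "T \<in> Pow {1..N}"
  have "(\<lambda>\<omega>. gradient (\<phi>i i) (h \<omega>)) \<in> borel_measurable Q" if "i \<in> T" for i
    using cont T that by (intro borel_measurable_continuous_on[OF _ h]) auto
  thus "(\<lambda>\<omega>. avg_grad \<phi>i T (h \<omega>)) \<in> borel_measurable Q"
    unfolding avg_grad_def by (intro borel_measurable_scaleR borel_measurable_sum) auto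
qed (auto intro: countable_finite)

lemma pred_sample_decrease:
  fixes h h' :: "'a \<Rightarrow> 'b::{real_inner, second_countable_topology}"
  assumes "S \<in> measurable Q (count_space (Pow {1..N}))" "h \<in> borel_measurable Q" "h' \<in> borel_measurable Q"
    and "\<And>i. i \<in> {1..N} \<Longrightarrow> continuous_on UNIV (\<phi>i i)"
    and "\<And>i. i \<in> {1..N} \<Longrightarrow> continuous_on UNIV (gradient (\<phi>i i))"
  shows "Measurable.pred Q (\<lambda>\<omega>. sample_decrease \<phi>i (S \<omega>) cmin Cmax \<zeta> (h \<omega>) (h' \<omega>))"
proof -
  note [measurable] = borel_measurable_avg_sample[OF assms(1,2,4)] borel_measurable_avg_sample[OF assms(1,3,4)]
    borel_measurable_avg_grad_sample[OF assms(1,2,5)]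
  show ?thesis unfolding sample_decrease_def by measurable
qed

lemma borel_measurable_armijo_step:
  fixes x g d :: "'a \<Rightarrow> 'b::{real_inner, second_countable_topology}"
  assumes S: "S \<in> measurable Q (count_space (Pow {1..N}))"
    and [measurable]: "x \<in> borel_measurable Q" "g \<in> borel_measurable Q" "d \<in> borel_measurable Q"
    and cont: "\<And>i. i \<in> {1..N} \<Longrightarrow> continuous_on UNIV (\<phi>i i)"
  shows "(\<lambda>\<omega>. \<beta> ^ (LEAST j. nonmonotone_armijo (avg \<phi>i (S \<omega>)) \<eta> \<zeta> (x \<omega>) (g \<omega>) (d \<omega>) (\<beta> ^ j)) :: real)
    \<in> borel_measurable Q"
proof -
  have "Measurable.pred Q (\<lambda>\<omega>. nonmonotone_armijo (avg \<phi>i (S \<omega>)) \<eta> \<zeta> (x \<omega>) (g \<omega>) (d \<omega>) (\<beta> ^ j))" for j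
  proof -
    have [measurable]: "(\<lambda>\<omega>. avg \<phi>i (S \<omega>) (x \<omega>)) \<in> borel_measurable Q"
      "(\<lambda>\<omega>. avg \<phi>i (S \<omega>) (x \<omega> + \<beta> ^ j *\<^sub>R d \<omega>)) \<in> borel_measurable Q"
      by (intro borel_measurable_avg_sample[OF S _ cont]; measurable)+
    show ?thesis unfolding nonmonotone_armijo_def by measurable
  qed
  hence "(\<lambda>\<omega>. LEAST j. nonmonotone_armijo (avg \<phi>i (S \<omega>)) \<eta> \<zeta> (x \<omega>) (g \<omega>) (d \<omega>) (\<beta> ^ j))
      \<in> measurable Q (count_space UNIV)"
    by (rule measurable_Least)
  thus ?thesis by (rule measurable_compose) simp
qed

lemma (in prob_space) line_search_failures_summable:
  fixes x g d :: "nat \<Rightarrow> 'a \<Rightarrow> real ^ 'n" and B :: "nat \<Rightarrow> 'a \<Rightarrow> real ^ 'n ^ 'n"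
    and Kf :: "nat \<Rightarrow> 'a \<Rightarrow> nat"
  assumes cont: "\<And>i. i \<in> {1..N} \<Longrightarrow> continuous_on UNIV (\<phi>i i)"
      "\<And>i. i \<in> {1..N} \<Longrightarrow> continuous_on UNIV (gradient (\<phi>i i))"
    and c_pos: "cmin > 0"
    and meas: "\<And>k. x k \<in> borel_measurable M" "\<And>k. g k \<in> borel_measurable M"
      "\<And>k. d k \<in> borel_measurable M" "\<And>k. B k \<in> borel_measurable M"
    and init: "\<And>\<omega>. \<omega> \<in> space M \<Longrightarrow> Kf 0 \<omega> = 0 \<and> \<not> ind 0 \<omega>"
    and Ns: "\<And>k. Ns k \<in> measurable M (count_space (Pow {1..N}))"
    and Ds: "\<And>k. uniform_sample M (before_Ds M N x B Ns g d Ds k) {\<omega> \<in> space M. \<not> ind k \<omega>} N (Ds k)"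
    and line_search: "\<And>k \<omega>. \<omega> \<in> space M \<Longrightarrow> \<not> ind k \<omega> \<Longrightarrow>
      (\<exists>j. t k \<omega> = \<beta> ^ j \<and>
           nonmonotone_armijo (avg \<phi>i (Ns k \<omega>)) \<eta> (\<zeta> k) (x k \<omega>) (g k \<omega>) (d k \<omega>) (\<beta> ^ j) \<and>
           (\<forall>i<j. \<not> nonmonotone_armijo (avg \<phi>i (Ns k \<omega>)) \<eta> (\<zeta> k) (x k \<omega>) (g k \<omega>) (d k \<omega>) (\<beta> ^ i)))"
    and update_ls: "\<And>k \<omega>. \<omega> \<in> space M \<Longrightarrow> \<not> ind k \<omega> \<Longrightarrow>
      (let xbar = x k \<omega> + t k \<omega> *\<^sub>R d k \<omega> in
       if sample_decrease \<phi>i (Ds k \<omega>) cmin Cmax (\<zeta> k) (x k \<omega>) xbar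
       then x (Suc k) \<omega> = xbar \<and> Kf (Suc k) \<omega> = Kf k \<omega> \<and> ind (Suc k) \<omega> = ind k \<omega>
       else x (Suc k) \<omega> = x k \<omega> \<and> Kf (Suc k) \<omega> = Kf k \<omega> + 1 \<and>
            ind (Suc k) \<omega> = (Kf (Suc k) \<omega> > Kmax))"
    and update_sa: "\<And>k \<omega>. \<omega> \<in> space M \<Longrightarrow> ind k \<omega> \<Longrightarrow>
      Kf (Suc k) \<omega> = Kf k \<omega> \<and> ind (Suc k) \<omega> = ind k \<omega>"
  defines "J \<equiv> \<lambda>k. {\<omega> \<in> space M. \<not> ind k \<omega> \<and>
      \<not> sample_decrease \<phi>i {1..N} cmin Cmax (\<zeta> k) (x k \<omega>) (x (Suc k) \<omega>)}"
  shows "J k \<in> events" "summable (\<lambda>k. prob (J k))"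
proof -
  note [measurable] = meas Ns
  define G where "G = before_Ds M N x B Ns g d Ds"
  have DsM[measurable]: "Ds k \<in> measurable M (count_space (Pow {1..N}))" for k
    using Ds[of k] by (simp add: uniform_sample_def)
  \<comment> \<open>The trial point in closed form. \<open>t k\<close> is constrained to be the
    Armijo step only in the first phase, whereas this formula is measurable everywhere, also where
    no exponent passes the test and \<open>LEAST\<close> is merely some fixed number.\<close>
  define y where "y = (\<lambda>k \<omega>. x k \<omega> + \<beta> ^ (LEAST j. nonmonotone_armijo (avg \<phi>i (Ns k \<omega>)) \<eta> (\<zeta> k)
      (x k \<omega>) (g k \<omega>) (d k \<omega>) (\<beta> ^ j)) *\<^sub>R d k \<omega>)"
  have y: "x k \<omega> + t k \<omega> *\<^sub>R d k \<omega> = y k \<omega>" if \<omega>: "\<omega> \<in> space M" "\<not> ind k \<omega>" for k \<omega>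
  proof -
    obtain j where j: "t k \<omega> = \<beta> ^ j"
      "nonmonotone_armijo (avg \<phi>i (Ns k \<omega>)) \<eta> (\<zeta> k) (x k \<omega>) (g k \<omega>) (d k \<omega>) (\<beta> ^ j)"
      "\<forall>i<j. \<not> nonmonotone_armijo (avg \<phi>i (Ns k \<omega>)) \<eta> (\<zeta> k) (x k \<omega>) (g k \<omega>) (d k \<omega>) (\<beta> ^ i)"
      using line_search[OF \<omega>] by blast
    hence "(LEAST j. nonmonotone_armijo (avg \<phi>i (Ns k \<omega>)) \<eta> (\<zeta> k) (x k \<omega>) (g k \<omega>) (d k \<omega>) (\<beta> ^ j)) = j"
      by (intro Least_equality) (auto simp: not_less[symmetric])
    thus ?thesis by (simp add: y_def j(1))
  qed
  have yQ: "y k \<in> borel_measurable Q"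
    if [measurable]: "x k \<in> borel_measurable Q" "g k \<in> borel_measurable Q" "d k \<in> borel_measurable Q"
      "Ns k \<in> measurable Q (count_space (Pow {1..N}))" for k Q
  proof -
    note [measurable] = borel_measurable_armijo_step[OF that(4,1,2,3) cont(1), where \<beta> = \<beta> and \<eta> = \<eta> and \<zeta> = "\<zeta> k"]
    show ?thesis unfolding y_def by measurable
  qed
  have yM[measurable]: "y k \<in> borel_measurable M" for k by (rule yQ[OF meas(1-3) Ns])
  define rej where "rej = (\<lambda>k \<omega>. \<not> sample_decrease \<phi>i (Ds k \<omega>) cmin Cmax (\<zeta> k) (x k \<omega>) (y k \<omega>))"
  have rejM[measurable]: "Measurable.pred M (rej k)" for k
    unfolding rej_def using pred_sample_decrease[OF DsM meas(1) yM cont] by measurable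
  have ls: "if rej k \<omega> then x (Suc k) \<omega> = x k \<omega> \<and> Kf (Suc k) \<omega> = Kf k \<omega> + 1 \<and> ind (Suc k) \<omega> = (Kf k \<omega> + 1 > Kmax)
      else x (Suc k) \<omega> = y k \<omega> \<and> Kf (Suc k) \<omega> = Kf k \<omega> \<and> \<not> ind (Suc k) \<omega>"
    if "\<omega> \<in> space M" "\<not> ind k \<omega>" for k \<omega>
    using update_ls[OF that] that(2) unfolding Let_def y[OF that] rej_def by (auto split: if_splits)

  \<comment> \<open>Measurability of the counter and of the phase flag propagates from the constant
    initial state through the update rules.\<close>
  have state: "Kf k \<in> measurable M (count_space UNIV) \<and> Measurable.pred M (ind k)" for k
  proof (induction k)
    case 0
    have "Kf 0 \<in> measurable M (count_space UNIV) \<longleftrightarrow> (\<lambda>_. 0 :: nat) \<in> measurable M (count_space UNIV)"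
      using init by (intro measurable_cong) auto
    moreover have "Measurable.pred M (ind 0) \<longleftrightarrow> Measurable.pred M (\<lambda>_. False)"
      using init by (intro measurable_cong) auto
    ultimately show ?case by simp
  next
    case (Suc k)
    hence [measurable]: "Kf k \<in> measurable M (count_space UNIV)" "Measurable.pred M (ind k)" by auto
    have "Kf (Suc k) \<in> measurable M (count_space UNIV) \<longleftrightarrow>
        (\<lambda>\<omega>. if ind k \<omega> then Kf k \<omega> else if rej k \<omega> then Kf k \<omega> + 1 else Kf k \<omega>) \<in> measurable M (count_space UNIV)"
      using ls update_sa by (intro measurable_cong) (auto split: if_splits)
    moreover have "Measurable.pred M (ind (Suc k)) \<longleftrightarrow>
        Measurable.pred M (\<lambda>\<omega>. if ind k \<omega> then True else if rej k \<omega> then Kf k \<omega> + 1 > Kmax else False)"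
      using ls update_sa by (intro measurable_cong) (auto split: if_splits)
    ultimately show ?case by simp
  qed
  have indM[measurable]: "Measurable.pred M (ind k)" for k using state by blast
  have const[measurable]: "(\<lambda>_. {1..N}) \<in> measurable M (count_space (Pow {1..N}))" by simp
  note [measurable] = pred_sample_decrease[OF const meas(1) meas(1) cont] pred_sample_decrease[OF const meas(1) yM cont]
  show JM: "J k \<in> events" for k unfolding J_def by measurable

  define R where "R = (\<lambda>k. {\<omega> \<in> space M. \<not> ind k \<omega> \<and> rej k \<omega>})"
  have RM[measurable]: "R k \<in> events" for k unfolding R_def by measurable
  have count: "(\<Sum>j<k. indicator (R j) \<omega>) \<le> real (Kf k \<omega>)" if "\<omega> \<in> space M" for k \<omega>
  proof (induction k)
    case (Suc k)
    have "indicator (R k) \<omega> + real (Kf k \<omega>) \<le> Kf (Suc k) \<omega>"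
      using ls[OF that, of k] update_sa[OF that, of k] that
      by (cases "ind k \<omega>") (auto simp: R_def indicator_def split: if_splits)
    thus ?case using Suc by simp
  qed simp
  \<comment> \<open>While the flag is false the count is at most \<open>Kmax\<close>; the one
    further rejection that ends the phase gives \<open>Kmax + 1\<close>.\<close>
  have Kf_le: "Kf k \<omega> \<le> Kmax + 1 \<and> (\<not> ind k \<omega> \<longrightarrow> Kf k \<omega> \<le> Kmax)" if "\<omega> \<in> space M" for k \<omega>
  proof (induction k)
    case 0
    thus ?case using init[OF that] by simp
  next
    case (Suc k)
    thus ?case using ls[OF that, of k] update_sa[OF that, of k]
      by (cases "ind k \<omega>") (auto split: if_splits)
  qed
  have "(\<Sum>j<k. prob (R j)) \<le> real (Kmax + 1)" for k
  proof -
    have "(\<Sum>j<k. prob (R j)) = expectation (\<lambda>\<omega>. \<Sum>j<k. indicator (R j) \<omega>)"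
      by (subst Bochner_Integration.integral_sum) (auto simp: less_top[symmetric])
    also have "\<dots> \<le> expectation (\<lambda>_. real (Kmax + 1))"
    proof (rule integral_mono)
      fix \<omega> assume \<omega>: "\<omega> \<in> space M"
      have "(\<Sum>j<k. indicator (R j) \<omega>) \<le> real (Kf k \<omega>)" using count[OF \<omega>] .
      also have "\<dots> \<le> real (Kmax + 1)" using Kf_le[OF \<omega>, of k] by (simp only: of_nat_le_iff)
      finally show "(\<Sum>j<k. indicator (R j) \<omega>) \<le> real (Kmax + 1)" .
    qed (auto intro!: Bochner_Integration.integrable_sum simp: less_top[symmetric])
    finally show ?thesis by (simp add: prob_space)
  qed
  hence sumR: "summable (\<lambda>k. prob (R k))" by (intro summableI_nonneg_bounded) auto

  have J: "prob (J k) \<le> prob (R k) + 2 ^ N * prob (R k)" for k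
  proof -
    \<comment> \<open>The test is made at the trial point \<open>y k\<close>, known before
      \<open>Ds k\<close> is drawn, and not at \<open>x (Suc k)\<close>, which depends on the draw.
      For a fixed set \<open>S\<close> the outcome of its test is then an event of
      \<open>G k\<close>.\<close>
    define Z where "Z = {\<omega> \<in> space M. \<not> ind k \<omega> \<and> \<not> sample_decrease \<phi>i {1..N} cmin Cmax (\<zeta> k) (x k \<omega>) (y k \<omega>)}"
    have ZM: "Z \<in> events" unfolding Z_def by measurable
    define gens where "gens = past_events M N x B Ns g d Ds k \<union> preimages M (count_space (Pow {1..N})) (Ns k) \<union>
      preimages M borel (g k) \<union> preimages M borel (d k)"
    have G: "G k = sigma (space M) gens" by (simp add: G_def before_Ds_def gens_def)
    have gens: "gens \<subseteq> events"
      unfolding gens_def past_events_def using meas Ns DsM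
      by (intro Un_least UN_least preimages_subset_sets) auto
    have GM: "subalgebra M (G k)" unfolding G by (rule subalgebra_sigma[OF gens])
    have gensP: "gens \<subseteq> Pow (space M)" using gens sets.space_closed by blast
    have xG[measurable]: "x k \<in> borel_measurable (G k)"
      unfolding G by (rule measurable_sigma_preimages[OF meas(1) _ gensP]) (auto simp: gens_def past_events_def)
    have gG[measurable]: "g k \<in> borel_measurable (G k)"
      unfolding G by (rule measurable_sigma_preimages[OF meas(2) _ gensP]) (auto simp: gens_def)
    have dG[measurable]: "d k \<in> borel_measurable (G k)"
      unfolding G by (rule measurable_sigma_preimages[OF meas(3) _ gensP]) (auto simp: gens_def)
    have NsG[measurable]: "Ns k \<in> measurable (G k) (count_space (Pow {1..N}))"
      unfolding G by (rule measurable_sigma_preimages[OF Ns _ gensP]) (auto simp: gens_def)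
    have [measurable]: "y k \<in> borel_measurable (G k)" by (rule yQ[OF xG gG dG NsG])
    have "prob Z \<le> 2 ^ N * prob {\<omega> \<in> {\<omega> \<in> space M. \<not> ind k \<omega>}.
        \<omega> \<in> {\<omega>' \<in> space M. \<not> sample_decrease \<phi>i (Ds k \<omega>) cmin Cmax (\<zeta> k) (x k \<omega>') (y k \<omega>')}}"
    proof (rule prob_le_uniform_sample[OF Ds, where A = "\<lambda>S. {\<omega>' \<in> space M. \<not> sample_decrease \<phi>i S cmin Cmax (\<zeta> k) (x k \<omega>') (y k \<omega>')}"])
      show "sets (before_Ds M N x B Ns g d Ds k) \<subseteq> events"
        using GM by (simp add: G_def subalgebra_def)
      fix S assume "S \<subseteq> {1..N}"
      hence "(\<lambda>_. S) \<in> measurable (G k) (count_space (Pow {1..N}))" by simp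
      hence [measurable]: "Measurable.pred (G k) (\<lambda>\<omega>. sample_decrease \<phi>i S cmin Cmax (\<zeta> k) (x k \<omega>) (y k \<omega>))"
        by (intro pred_sample_decrease[OF _ _ _ cont]) auto
      have "{\<omega> \<in> space (G k). \<not> sample_decrease \<phi>i S cmin Cmax (\<zeta> k) (x k \<omega>) (y k \<omega>)} \<in> sets (G k)"
        by measurable
      moreover have "space (G k) = space M" using GM by (simp add: subalgebra_def)
      ultimately show "{\<omega>' \<in> space M. \<not> sample_decrease \<phi>i S cmin Cmax (\<zeta> k) (x k \<omega>') (y k \<omega>')}
          \<in> sets (before_Ds M N x B Ns g d Ds k)"
        by (simp add: G_def)
    next
      fix \<omega> assume "\<omega> \<in> Z"
      hence \<omega>: "\<omega> \<in> space M" "\<not> ind k \<omega>" and fail: "\<not> sample_decrease \<phi>i {1..N} cmin Cmax (\<zeta> k) (x k \<omega>) (y k \<omega>)"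
        by (auto simp: Z_def)
      have "Ds k \<omega> \<noteq> {}" using Ds[of k] \<omega> unfolding uniform_sample_def by blast
      moreover have sub: "Ds k \<omega> \<subseteq> {1..N}" using measurable_space[OF DsM \<omega>(1), of k] by simp
      ultimately have "1 \<le> card (Ds k \<omega>)" "card (Ds k \<omega>) \<le> N"
        using card_mono[OF _ sub] finite_subset[OF sub] by (auto simp: Suc_le_eq card_gt_0_iff)
      hence "\<exists>S\<subseteq>{1..N}. card S = card (Ds k \<omega>) \<and> \<not> sample_decrease \<phi>i S cmin Cmax (\<zeta> k) (x k \<omega>) (y k \<omega>)"
        using sample_decrease_full_if_all_of_size[OF _ _ c_pos] fail by metis
      thus "\<omega> \<in> {\<omega> \<in> space M. \<not> ind k \<omega>} \<and> (\<exists>S\<subseteq>{1..N}. card S = card (Ds k \<omega>) \<and>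
          \<omega> \<in> {\<omega>' \<in> space M. \<not> sample_decrease \<phi>i S cmin Cmax (\<zeta> k) (x k \<omega>') (y k \<omega>')})"
        using \<omega> by simp
    qed (use ZM in measurable)
    also have "{\<omega> \<in> {\<omega> \<in> space M. \<not> ind k \<omega>}.
        \<omega> \<in> {\<omega>' \<in> space M. \<not> sample_decrease \<phi>i (Ds k \<omega>) cmin Cmax (\<zeta> k) (x k \<omega>') (y k \<omega>')}} = R k"
      by (auto simp: R_def rej_def)
    finally have Z: "prob Z \<le> 2 ^ N * prob (R k)" .
    \<comment> \<open>A step that is not rejected moves to \<open>y k\<close>, so failing the full
      decrease there puts the outcome in \<open>Z\<close>.\<close>
    have "J k \<subseteq> R k \<union> Z"
      using ls[of _ k] by (fastforce simp: J_def R_def Z_def split: if_splits)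
    hence "prob (J k) \<le> prob (R k \<union> Z)" using ZM by (intro finite_measure_mono) auto
    also have "\<dots> \<le> prob (R k) + prob Z" using ZM by (intro measure_Un_le) auto
    finally show ?thesis using Z by linarith
  qed
  show "summable (\<lambda>k. prob (J k))"
  proof (rule summable_comparison_test')
    show "summable (\<lambda>k. prob (R k) + 2 ^ N * prob (R k))"
      using sumR by (intro summable_add summable_mult)
  qed (use J in auto)
qed

section \<open>One step of the method\<close>

lemma norm_diff_plus_square_le:
  fixes u \<xi> :: "'a::real_inner"
  shows "(norm (u + \<xi>))\<^sup>2 \<le> 2 * (norm u)\<^sup>2 + 2 * (norm \<xi>)\<^sup>2"
proof -
  have "0 \<le> (norm (u - \<xi>))\<^sup>2" by simp
  thus ?thesis unfolding power2_norm_eq_inner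
    by (simp add: inner_add_left inner_add_right inner_diff_left inner_diff_right inner_commute)
qed

text \<open>By symmetry \<open>u \<bullet> d\<close> equals \<open>y \<bullet> (B *v d)\<close>,
  where \<open>B *v y = u\<close>, and \<open>B *v d\<close> is \<open>- g\<close> up to the
  residual. Only the residual is estimated by norms. The noise stays in the exact term
  \<open>y \<bullet> (g - u)\<close>, whose expectation can vanish because \<open>y\<close> depends
  on \<open>B\<close> and \<open>u\<close> alone.\<close>

lemma inexact_newton_direction_bounds:
  fixes B :: "real ^ 'n ^ 'n"
  assumes B: "transpose B = B" "loewner_le (mat \<mu>) B" "loewner_le B (mat L)"
    and \<mu>: "\<mu> > 0" and L: "L > 0"
    and d: "norm (B *v d + g) \<le> \<delta> * norm g" and \<delta>: "0 \<le> \<delta>" "\<delta> \<le> \<Delta>"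
  shows "u \<bullet> d \<le> - (norm u)\<^sup>2 / L - cramer_solution B u \<bullet> (g - u)
      + \<delta> / \<mu> * (3 / 2 * (norm u)\<^sup>2 + (norm (g - u))\<^sup>2)" (is ?bound)
    and "(norm d)\<^sup>2 \<le> ((1 + \<Delta>) / \<mu>)\<^sup>2 * (2 * (norm u)\<^sup>2 + 2 * (norm (g - u))\<^sup>2)"
    and "norm (cramer_solution B u) \<le> norm u / \<mu>"
proof -
  define y where "y = cramer_solution B u"
  have By: "B *v y = u" unfolding y_def using B(2) \<mu> by (rule cramer_solution)
  have pos: "0 \<le> w \<bullet> (B *v w)" for w
    using loewner_matD[OF B(2), of w] \<mu> by (meson order_trans zero_le_power2 mult_nonneg_nonneg less_imp_le)
  have ny: "norm y \<le> norm u / \<mu>" using norm_le_loewner_lower[OF B(2) \<mu>, of y] By by simp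
  thus "norm (cramer_solution B u) \<le> norm u / \<mu>" by (simp add: y_def)
  have g2: "(norm g)\<^sup>2 \<le> 2 * (norm u)\<^sup>2 + 2 * (norm (g - u))\<^sup>2"
    using norm_diff_plus_square_le[of u "g - u"] by simp
  have yu: "(norm u)\<^sup>2 / L \<le> y \<bullet> u"
    using norm_mult_le_loewner_upper[OF B(1) pos B(3) L, of y] L unfolding By by (simp add: field_simps)
  have "u \<bullet> d = y \<bullet> (B *v d)" using inner_symmetric_matrix[OF B(1), of y d] By by simp
  also have "\<dots> = y \<bullet> (B *v d + g) - y \<bullet> u - y \<bullet> (g - u)" by (simp add: inner_add_right inner_diff_right)
  finally have ud: "u \<bullet> d = y \<bullet> (B *v d + g) - y \<bullet> u - y \<bullet> (g - u)" .
  have "y \<bullet> (B *v d + g) \<le> norm y * norm (B *v d + g)" by (rule norm_cauchy_schwarz)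
  also have "\<dots> \<le> (norm u / \<mu>) * (\<delta> * norm g)"
    using ny d \<mu> \<delta> by (intro mult_mono) auto
  also have "\<dots> = \<delta> / \<mu> * (norm u * norm g)" by simp
  \<comment> \<open>The coefficient \<open>3 / 2\<close> is \<open>1 / 2\<close> from Young's
    inequality plus \<open>1\<close>, half of the factor 2 in \<open>g2\<close>.\<close>
  also have "\<dots> \<le> \<delta> / \<mu> * (3 / 2 * (norm u)\<^sup>2 + (norm (g - u))\<^sup>2)"
  proof (rule mult_left_mono)
    have "0 \<le> (norm u - norm g)\<^sup>2" by simp
    hence "norm u * norm g \<le> (norm u)\<^sup>2 / 2 + (norm g)\<^sup>2 / 2" by (simp add: power2_diff)
    thus "norm u * norm g \<le> 3 / 2 * (norm u)\<^sup>2 + (norm (g - u))\<^sup>2" using g2 by linarith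
  qed (use \<delta> \<mu> in auto)
  finally show ?bound using ud yu unfolding y_def by linarith
  have "norm (B *v d) \<le> norm (B *v d + g) + norm g" using norm_triangle_ineq4[of "B *v d + g" g] by simp
  hence "norm (B *v d) \<le> (1 + \<Delta>) * norm g"
    using d mult_right_mono[OF \<delta>(2) norm_ge_zero[of g]] by (simp add: algebra_simps)
  hence "norm d \<le> (1 + \<Delta>) / \<mu> * norm g"
    using norm_le_loewner_lower[OF B(2) \<mu>, of d] \<mu> by (simp add: field_simps)
  hence "(norm d)\<^sup>2 \<le> ((1 + \<Delta>) / \<mu> * norm g)\<^sup>2" by (intro power_mono) auto
  also have "\<dots> = ((1 + \<Delta>) / \<mu>)\<^sup>2 * (norm g)\<^sup>2" by (rule power_mult_distrib)
  also have "\<dots> \<le> ((1 + \<Delta>) / \<mu>)\<^sup>2 * (2 * (norm u)\<^sup>2 + 2 * (norm (g - u))\<^sup>2)"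
    using g2 by (intro mult_left_mono) auto
  finally show "(norm d)\<^sup>2 \<le> ((1 + \<Delta>) / \<mu>)\<^sup>2 * (2 * (norm u)\<^sup>2 + 2 * (norm (g - u))\<^sup>2)" .
qed

text \<open>The key is \<open>- cmin |u|\<^sup>2 \<le> \<alpha> u \<bullet> d + \<alpha>\<^sup>2 |d|\<^sup>2 / (4 cmin)\<close>, which lets a line-search step pass for a
  predefined step along any \<open>d\<close>. The number \<open>j\<close> is the indicator of an exceptional step.\<close>

lemma step_suboptimality_bound:
  fixes u d :: "'a::real_inner"
  assumes v: "0 \<le> v" "0 \<le> v'" "(norm u)\<^sup>2 \<le> 4 * L * b" and c: "cmin > 0" and L: "L > 0"
    and \<zeta>: "0 \<le> \<zeta>" and b: "0 \<le> b"
    and alt: "v' \<le> v + \<alpha> * (u \<bullet> d) + L * \<alpha>\<^sup>2 * (norm d)\<^sup>2 \<or> v' \<le> v - cmin * (norm u)\<^sup>2 + \<zeta> \<or> j = 1"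
    and j: "j = 0 \<or> j = (1 :: real)"
  shows "min v' b \<le> v + \<alpha> * (u \<bullet> d) + (L + 1 / (4 * cmin)) * \<alpha>\<^sup>2 * (norm d)\<^sup>2 + \<zeta>
      + b * (1 + 4 * L * cmin) * j"
proof -
  define s where "s = 1 / (4 * cmin) * \<alpha>\<^sup>2 * (norm d)\<^sup>2"
  define r where "r = L * \<alpha>\<^sup>2 * (norm d)\<^sup>2"
  have s: "0 \<le> s" using c by (simp add: s_def)
  have r: "0 \<le> r" using L by (simp add: r_def)
  have "0 \<le> (norm ((2 * cmin) *\<^sub>R u + \<alpha> *\<^sub>R d))\<^sup>2 / (4 * cmin)" using c by simp
  also have "(norm ((2 * cmin) *\<^sub>R u + \<alpha> *\<^sub>R d))\<^sup>2
      = 4 * cmin * (cmin * (norm u)\<^sup>2 + \<alpha> * (u \<bullet> d)) + \<alpha>\<^sup>2 * (norm d)\<^sup>2"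
    unfolding power2_norm_eq_inner
    by (simp add: inner_add_left inner_add_right inner_commute power2_eq_square algebra_simps)
  also have "\<dots> / (4 * cmin) = cmin * (norm u)\<^sup>2 + \<alpha> * (u \<bullet> d) + s"
    using c by (simp add: s_def add_divide_distrib)
  finally have sq: "- (cmin * (norm u)\<^sup>2) \<le> \<alpha> * (u \<bullet> d) + s" by simp
  \<comment> \<open>For an exceptional step, \<open>min v' b\<close> is at most \<open>b\<close>,
    but \<open>\<alpha> * (u \<bullet> d)\<close> may be negative. By \<open>sq\<close> the latter
    together with \<open>s\<close> is at least \<open>- cmin * (norm u)\<^sup>2\<close>, hence at
    least \<open>- 4 * L * cmin * b\<close>; this explains the factor
    \<open>1 + 4 * L * cmin\<close>.\<close>
  have cu: "cmin * (norm u)\<^sup>2 \<le> 4 * L * cmin * b"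
    using mult_left_mono[OF v(3), of cmin] c by (simp add: mult_ac)
  have jb: "0 \<le> b * (1 + 4 * L * cmin) * j" using j b c L by auto
  define w where "w = \<alpha> * (u \<bullet> d)"
  define m where "m = cmin * (norm u)\<^sup>2"
  define q where "q = b * (1 + 4 * L * cmin) * j"
  have q1: "q = b + 4 * L * cmin * b" if "j = 1" using that by (simp add: q_def algebra_simps)
  have "min v' b \<le> v + w + r + s + \<zeta> + q"
    using alt unfolding r_def[symmetric] w_def[symmetric] m_def[symmetric]
  proof (elim disjE)
    assume "v' \<le> v + w + r"
    thus ?thesis using s \<zeta> jb unfolding q_def[symmetric] by linarith
  next
    assume "v' \<le> v - m + \<zeta>"
    thus ?thesis using sq r jb unfolding q_def[symmetric] w_def[symmetric] m_def[symmetric] by linarith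
  next
    assume "j = 1"
    thus ?thesis using v(1) sq cu r \<zeta> q1 unfolding w_def[symmetric] m_def[symmetric] by linarith
  qed
  thus ?thesis by (simp add: r_def s_def w_def q_def algebra_simps)
qed

text \<open>A pointwise majorant \<open>H\<close> is integrated. Its noise term has mean zero by
  conditional independence, and the alternatives in \<open>alt\<close> share the same majorant, so
  no conditioning on the phase is needed.\<close>

lemma (in prob_space) stochastic_newton_step:
  fixes X X' g d :: "'a \<Rightarrow> real ^ 'n" and B :: "'a \<Rightarrow> real ^ 'n ^ 'n"
  assumes G: "\<And>x. GDERIV f x :> G x" and L: "L > 0" "lipschitz_on L UNIV G"
    and \<mu>: "\<mu> > 0" "strongly_convex \<mu> f" and z: "\<And>x. f z \<le> f x"
    and F: "subalgebra M F" and X: "X \<in> borel_measurable F"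
    and meas: "X' \<in> borel_measurable M" "g \<in> borel_measurable M" "B \<in> borel_measurable M"
    and ci: "cond_indep_var M F g B"
    and mean: "AE \<omega> in M. vec_cond_exp M F g \<omega> = G (X \<omega>)"
    and var: "AE \<omega> in M. nn_cond_exp M F (\<lambda>\<omega>. ennreal ((norm (G (X \<omega>) - g \<omega>))\<^sup>2)) \<omega> \<le> ennreal c1"
    and c1: "c1 > 0"
    and B: "AE \<omega> in M. transpose (B \<omega>) = B \<omega> \<and> loewner_le (mat \<mu>) (B \<omega>) \<and> loewner_le (B \<omega>) (mat L)"
    and d: "\<And>\<omega>. \<omega> \<in> space M \<Longrightarrow> norm (B \<omega> *v d \<omega> + g \<omega>) \<le> \<delta> * norm (g \<omega>)"
    and \<delta>: "0 \<le> \<delta>" "\<delta> \<le> \<Delta>" and \<alpha>: "\<alpha> > 0" and \<zeta>: "0 \<le> \<zeta>" and cmin: "cmin > 0"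
    and J: "J \<in> events"
    and alt: "\<And>\<omega>. \<omega> \<in> space M \<Longrightarrow> X' \<omega> = X \<omega> + \<alpha> *\<^sub>R d \<omega> \<or>
      f (X' \<omega>) \<le> f (X \<omega>) - cmin * (norm (G (X \<omega>)))\<^sup>2 + \<zeta> \<or> \<omega> \<in> J"
    and A: "A \<in> sets F" and b: "b > 0"
  defines "V \<equiv> \<lambda>x. f x - f z"
  shows "(\<integral>\<omega>. indicator A \<omega> * min (V (X' \<omega>)) b \<partial>M)
    \<le> (\<integral>\<omega>. indicator A \<omega> * min (V (X \<omega>)) b \<partial>M)
      - 2 * \<mu> / L * \<alpha> * (\<integral>\<omega>. indicator A \<omega> * (indicator {..<b} (V (X \<omega>)) * V (X \<omega>)) \<partial>M)
      + (1 + b) * ((6 * L + c1) / \<mu> * (\<delta> * \<alpha>)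
        + (L + 1 / (4 * cmin)) * ((1 + \<Delta>) / \<mu>)\<^sup>2 * (8 * L + 2 * c1) * \<alpha>\<^sup>2
        + \<zeta> + (1 + 4 * L * cmin) * prob J)"
proof -
  interpret F: sigma_finite_subalgebra M F using F by (rule sigma_finite_subalgebraI)
  have FM: "D \<in> events" if "D \<in> sets F" for D using F that by (auto simp: subalgebra_def)
  note [measurable] = meas J FM[OF A]
  have XM[measurable]: "X \<in> borel_measurable M" using measurable_from_subalg[OF F X] .
  have "continuous_on UNIV f"
    using G unfolding gderiv_def by (meson continuous_at_imp_continuous_on has_derivative_continuous)
  hence V[measurable]: "V \<in> borel_measurable borel"
    unfolding V_def by (intro borel_measurable_continuous_onI continuous_intros)
  have Gm[measurable]: "G \<in> borel_measurable borel"
    using lipschitz_on_continuous_on[OF L(2)] by (rule borel_measurable_continuous_onI)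
  have V0: "0 \<le> V x" for x using z[of x] by (simp add: V_def)
  define u where "u = (\<lambda>\<omega>. G (X \<omega>))"
  define \<xi> where "\<xi> = (\<lambda>\<omega>. g \<omega> - u \<omega>)"
  define y where "y = (\<lambda>\<omega>. cramer_solution (B \<omega>) (u \<omega>))"
  have uF: "u \<in> borel_measurable F" unfolding u_def using X Gm by (rule measurable_compose)
  have uM[measurable]: "u \<in> borel_measurable M" using measurable_from_subalg[OF F uF] .
  have \<xi>M[measurable]: "\<xi> \<in> borel_measurable M" unfolding \<xi>_def by measurable
  have u4: "(norm (u \<omega>))\<^sup>2 \<le> 4 * L * V (X \<omega>)" for \<omega>
    unfolding u_def V_def by (rule norm_gradient_le_suboptimality[OF G L(2,1) z])
  have u2: "2 * \<mu> * V (X \<omega>) \<le> (norm (u \<omega>))\<^sup>2" for \<omega>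
    unfolding u_def V_def by (rule strongly_convex_PL[OF \<mu>(2) G \<mu>(1)])

  \<comment> \<open>Below the level the gradient is bounded, which makes the products with the noise
    integrable. Above it the truncated value is already \<open>b\<close>, and the current step
    cannot raise it.\<close>
  define A' where "A' = {\<omega> \<in> A. V (X \<omega>) < b}"
  have A'F: "A' \<in> sets F"
  proof -
    have "(\<lambda>\<omega>. V (X \<omega>)) \<in> borel_measurable F" using X V by (rule measurable_compose)
    hence "{\<omega> \<in> space F. V (X \<omega>) < b} \<in> sets F" by (intro borel_measurable_less) auto
    moreover have "A' = A \<inter> {\<omega> \<in> space F. V (X \<omega>) < b}"
      using sets.sets_into_space[OF A] by (auto simp: A'_def)
    ultimately show ?thesis using A by auto
  qed
  note [measurable] = FM[OF A'F]
  have uA': "(norm (u \<omega>))\<^sup>2 \<le> 4 * L * b" if "\<omega> \<in> A'" for \<omega>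
  proof -
    have "4 * L * V (X \<omega>) \<le> 4 * L * b" using that L by (intro mult_left_mono) (auto simp: A'_def)
    thus ?thesis using u4[of \<omega>] by linarith
  qed

  \<comment> \<open>The conditional variance bound is integrated with nonnegative integrals, so that
    square integrability of the noise comes out as a result.\<close>
  have nn: "(\<integral>\<^sup>+ \<omega>. ennreal ((norm (\<xi> \<omega>))\<^sup>2) \<partial>M) \<le> ennreal c1"
  proof -
    have "(\<integral>\<^sup>+ \<omega>. ennreal ((norm (\<xi> \<omega>))\<^sup>2) \<partial>M) = (\<integral>\<^sup>+ \<omega>. 1 * ennreal ((norm (G (X \<omega>) - g \<omega>))\<^sup>2) \<partial>M)"
      by (simp add: \<xi>_def u_def norm_minus_commute)
    also have "\<dots> = (\<integral>\<^sup>+ \<omega>. 1 * nn_cond_exp M F (\<lambda>\<omega>. ennreal ((norm (G (X \<omega>) - g \<omega>))\<^sup>2)) \<omega> \<partial>M)"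
      by (rule F.nn_cond_exp_intg[symmetric]) measurable
    also have "\<dots> \<le> (\<integral>\<^sup>+ \<omega>. ennreal c1 \<partial>M)" using var by (intro nn_integral_mono_AE) auto
    finally show ?thesis by (simp add: emeasure_space_1)
  qed
  have i\<xi>: "integrable M (\<lambda>\<omega>. (norm (\<xi> \<omega>))\<^sup>2)"
    using nn by (intro integrableI_nonneg) (auto simp: le_less_trans[OF _ ennreal_less_top])
  have E\<xi>: "(\<integral>\<omega>. (norm (\<xi> \<omega>))\<^sup>2 \<partial>M) \<le> c1"
    using nn c1 by (subst integral_eq_nn_integral) (auto intro!: enn2real_leI)

  have ny: "AE \<omega> in M. norm (y \<omega>) \<le> norm (u \<omega>) / \<mu>"
    using B
  proof eventually_elim
    case (elim \<omega>)
    thus ?case unfolding y_def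
      by (intro order.trans[OF norm_le_loewner_lower[OF _ \<mu>(1)]])
         (auto simp: cramer_solution[OF _ \<mu>(1)])
  qed
  \<comment> \<open>The solution is a function of \<open>B\<close> and of the gradient at the
    current iterate, which places it in the algebra joined from \<open>F\<close> and
    \<open>B\<close>.\<close>
  have yM: "(\<lambda>\<omega>. y \<omega> $ i) \<in> borel_measurable (join_algebra M F B)" for i
    unfolding y_def
    using measurable_join_algebra_right[OF F meas(3)]
      measurable_from_subalg[OF subalgebra_join_algebra_left[OF F meas(3)] uF]
    by (rule borel_measurable_cramer_solution)
  have yM'[measurable]: "(\<lambda>\<omega>. y \<omega> $ i) \<in> borel_measurable M" for i
    using measurable_from_subalg[OF subalgebra_join_algebra[OF F meas(3)] yM] .
  have [measurable]: "(\<lambda>\<omega>. \<xi> \<omega> $ i) \<in> borel_measurable M" "(\<lambda>\<omega>. u \<omega> $ i) \<in> borel_measurable M"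
    "(\<lambda>\<omega>. g \<omega> $ i) \<in> borel_measurable M" for i
    by (intro borel_measurable_vec_nth; measurable)+
  have sq1: "t \<le> 1 + t\<^sup>2" for t :: real
  proof -
    have "0 \<le> t * t - t + 1 / 4" using zero_le_square[of "t - 1 / 2"] by (simp add: algebra_simps)
    thus ?thesis by (simp add: power2_eq_square)
  qed
  have i\<xi>y: "integrable M (\<lambda>\<omega>. y \<omega> $ i * (indicator A' \<omega> * \<xi> \<omega> $ i))" for i
  proof (rule Bochner_Integration.integrable_bound)
    show "integrable M (\<lambda>\<omega>. 4 * L * b / \<mu>\<^sup>2 + (norm (\<xi> \<omega>))\<^sup>2)" using i\<xi> by auto
    show "AE \<omega> in M. norm (y \<omega> $ i * (indicator A' \<omega> * \<xi> \<omega> $ i)) \<le> norm (4 * L * b / \<mu>\<^sup>2 + (norm (\<xi> \<omega>))\<^sup>2)"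
      using ny
    proof eventually_elim
      case (elim \<omega>)
      show ?case
      proof (cases "\<omega> \<in> A'")
        case True
        have "(norm (y \<omega>))\<^sup>2 \<le> (norm (u \<omega>) / \<mu>)\<^sup>2" using elim by (intro power_mono) auto
        also have "\<dots> \<le> 4 * L * b / \<mu>\<^sup>2"
          using uA'[OF True] by (simp add: power_divide divide_right_mono)
        finally have y2: "(norm (y \<omega>))\<^sup>2 \<le> 4 * L * b / \<mu>\<^sup>2" .
        have "0 \<le> (norm (y \<omega>) - norm (\<xi> \<omega>))\<^sup>2" by simp
        hence "norm (y \<omega>) * norm (\<xi> \<omega>) \<le> (norm (y \<omega>))\<^sup>2 / 2 + (norm (\<xi> \<omega>))\<^sup>2 / 2"
          by (simp add: power2_diff)
        also have "\<dots> \<le> (norm (y \<omega>))\<^sup>2 + (norm (\<xi> \<omega>))\<^sup>2"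
          using zero_le_power2[of "norm (y \<omega>)"] zero_le_power2[of "norm (\<xi> \<omega>)"] by linarith
        also have "\<dots> \<le> 4 * L * b / \<mu>\<^sup>2 + (norm (\<xi> \<omega>))\<^sup>2" using y2 by simp
        finally have "norm (y \<omega>) * norm (\<xi> \<omega>) \<le> 4 * L * b / \<mu>\<^sup>2 + (norm (\<xi> \<omega>))\<^sup>2" .
        moreover have "\<bar>y \<omega> $ i * \<xi> \<omega> $ i\<bar> \<le> norm (y \<omega>) * norm (\<xi> \<omega>)"
          unfolding abs_mult by (intro mult_mono component_le_norm_cart) auto
        ultimately show ?thesis using True by (simp add: abs_mult)
      next
        case False
        thus ?thesis by simp
      qed
    qed
  qed measurable
  \<comment> \<open>This is where conditional independence of \<open>g\<close> and \<open>B\<close>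
    is spent: componentwise, the noise is orthogonal to the gradient multiplied by the inverse of
    \<open>B\<close>.\<close>
  have y\<xi>0: "(\<integral>\<omega>. y \<omega> $ i * (indicator A' \<omega> * \<xi> \<omega> $ i) \<partial>M) = 0" for i
  proof -
    have "(\<integral>\<omega>. y \<omega> $ i * (indicator A' \<omega> * (g \<omega> $ i - u \<omega> $ i)) \<partial>M) = 0"
    proof (rule cond_indep_var_residual_orthogonal[OF F ci meas(2,3), where f = "\<lambda>v. v $ i"])
      show "(\<lambda>v :: real ^ 'n. v $ i) \<in> borel_measurable borel" by (rule borel_measurable_vec_nth) simp
      show "(\<lambda>\<omega>. u \<omega> $ i) \<in> borel_measurable F" using uF by (rule borel_measurable_vec_nth)
      show "AE \<omega> in M. real_cond_exp M F (\<lambda>\<omega>. g \<omega> $ i) \<omega> = u \<omega> $ i"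
        using mean by eventually_elim (simp add: vec_cond_exp_def u_def vec_eq_iff)
      show "integrable M (\<lambda>\<omega>. y \<omega> $ i * (indicator A' \<omega> * (g \<omega> $ i - u \<omega> $ i)))"
        using i\<xi>y[of i] by (simp add: \<xi>_def)
      show "integrable M (\<lambda>\<omega>. indicator A' \<omega> * g \<omega> $ i)"
      proof (rule Bochner_Integration.integrable_bound)
        show "integrable M (\<lambda>\<omega>. 1 + 8 * L * b + 2 * (norm (\<xi> \<omega>))\<^sup>2)" using i\<xi> by auto
        have "norm (indicator A' \<omega> * g \<omega> $ i) \<le> norm (1 + 8 * L * b + 2 * (norm (\<xi> \<omega>))\<^sup>2)" for \<omega>
        proof (cases "\<omega> \<in> A'")
          case True
          have "\<bar>g \<omega> $ i\<bar> \<le> 1 + (norm (g \<omega>))\<^sup>2"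
            using component_le_norm_cart[of "g \<omega>" i] sq1[of "norm (g \<omega>)"] by linarith
          also have "(norm (g \<omega>))\<^sup>2 \<le> 2 * (norm (u \<omega>))\<^sup>2 + 2 * (norm (\<xi> \<omega>))\<^sup>2"
            using norm_diff_plus_square_le[of "u \<omega>" "\<xi> \<omega>"] by (simp add: \<xi>_def)
          finally show ?thesis using True uA'[OF True] by simp
        qed (use L b in simp)
        thus "AE \<omega> in M. norm (indicator A' \<omega> * g \<omega> $ i) \<le> norm (1 + 8 * L * b + 2 * (norm (\<xi> \<omega>))\<^sup>2)"
          by simp
      qed measurable
    qed (fact A'F yM)+
    thus ?thesis by (simp add: \<xi>_def)
  qed
  define y\<xi> where "y\<xi> = (\<lambda>\<omega>. indicator A' \<omega> * (y \<omega> \<bullet> \<xi> \<omega>))"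
  have y\<xi>: "y\<xi> = (\<lambda>\<omega>. \<Sum>i\<in>UNIV. y \<omega> $ i * (indicator A' \<omega> * \<xi> \<omega> $ i))"
    by (simp add: y\<xi>_def inner_vec_def sum_distrib_left mult_ac)
  have iy\<xi>: "integrable M y\<xi>" unfolding y\<xi> by (intro Bochner_Integration.integrable_sum i\<xi>y)
  have y\<xi>0': "(\<integral>\<omega>. y\<xi> \<omega> \<partial>M) = 0"
    unfolding y\<xi> using y\<xi>0 by (subst Bochner_Integration.integral_sum) (auto intro: i\<xi>y)

  define C where "C = L + 1 / (4 * cmin)"
  define K where "K = ((1 + \<Delta>) / \<mu>)\<^sup>2"
  have CK: "0 \<le> C" "0 \<le> K" using L cmin by (auto simp: C_def K_def)
  \<comment> \<open>Errors from the inexact solve, the second-order term, the line-search slack and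
    exceptional steps, with \<open>4 * L * b\<close> put for the squared gradient. Nonnegativity of
    \<open>R\<close> makes the majorant valid off \<open>A'\<close> as well.\<close>
  define R where "R = (\<lambda>\<omega>. \<alpha> * (\<delta> / \<mu>) * (6 * L * b + (norm (\<xi> \<omega>))\<^sup>2)
      + C * \<alpha>\<^sup>2 * K * (8 * L * b + 2 * (norm (\<xi> \<omega>))\<^sup>2) + \<zeta> + b * (1 + 4 * L * cmin) * indicator J \<omega>)"
  have iR: "integrable M R"
    unfolding R_def using i\<xi>
    by (intro Bochner_Integration.integrable_add integrable_mult_right integrable_const) (auto simp: less_top[symmetric])
  have R0: "0 \<le> R \<omega>" for \<omega>
    unfolding R_def using \<alpha> \<delta> \<mu> L b CK \<zeta> cmin by (intro add_nonneg_nonneg mult_nonneg_nonneg) auto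
  define H where "H = (\<lambda>\<omega>. indicator A \<omega> * min (V (X \<omega>)) b
      - 2 * \<mu> / L * \<alpha> * (indicator A \<omega> * (indicator {..<b} (V (X \<omega>)) * V (X \<omega>))) - \<alpha> * y\<xi> \<omega> + R \<omega>)"
  have pointwise: "AE \<omega> in M. indicator A \<omega> * min (V (X' \<omega>)) b \<le> H \<omega>"
    using B AE_space
  proof eventually_elim
    case (elim \<omega>)
    hence \<omega>: "\<omega> \<in> space M" by simp
    show ?case
    proof (cases "\<omega> \<in> A'")
      case True
      hence "\<omega> \<in> A" and Vb: "V (X \<omega>) < b" by (auto simp: A'_def)
      let ?u2 = "(norm (u \<omega>))\<^sup>2" and ?x2 = "(norm (\<xi> \<omega>))\<^sup>2"
      have dir: "u \<omega> \<bullet> d \<omega> \<le> - ?u2 / L - y \<omega> \<bullet> \<xi> \<omega> + \<delta> / \<mu> * (3 / 2 * ?u2 + ?x2)"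
        "(norm (d \<omega>))\<^sup>2 \<le> K * (2 * ?u2 + 2 * ?x2)"
        using inexact_newton_direction_bounds[of "B \<omega>" \<mu> L "d \<omega>" "g \<omega>" \<delta> \<Delta> "u \<omega>"] elim \<mu>(1) L(1) d[OF \<omega>] \<delta>
        unfolding \<xi>_def y_def K_def by blast+
      have "min (V (X' \<omega>)) b \<le> V (X \<omega>) + \<alpha> * (u \<omega> \<bullet> d \<omega>) + (L + 1 / (4 * cmin)) * \<alpha>\<^sup>2 * (norm (d \<omega>))\<^sup>2 + \<zeta>
          + b * (1 + 4 * L * cmin) * indicator J \<omega>"
      proof (rule step_suboptimality_bound)
        show "V (X' \<omega>) \<le> V (X \<omega>) + \<alpha> * (u \<omega> \<bullet> d \<omega>) + L * \<alpha>\<^sup>2 * (norm (d \<omega>))\<^sup>2 \<or>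
            V (X' \<omega>) \<le> V (X \<omega>) - cmin * ?u2 + \<zeta> \<or> indicator J \<omega> = (1 :: real)"
          using alt[OF \<omega>]
        proof (elim disjE)
          assume "X' \<omega> = X \<omega> + \<alpha> *\<^sub>R d \<omega>"
          thus ?thesis
            using lipschitz_gradient_upper_bound[OF G L(2), of "X \<omega>" "\<alpha> *\<^sub>R d \<omega>"]
            by (simp add: V_def u_def power_mult_distrib inner_commute mult_ac)
        qed (auto simp: V_def u_def)
      qed (use V0 uA'[OF True] cmin L \<zeta> b in \<open>auto simp: indicator_def\<close>)
      \<comment> \<open>The Polyak-Lojasiewicz inequality turns \<open>- ?u2 / L\<close> into a
        drift with rate \<open>2 * \<mu> / L\<close>.\<close>
      also have "\<alpha> * (u \<omega> \<bullet> d \<omega>) \<le> \<alpha> * (- (2 * \<mu> * V (X \<omega>)) / L - y \<omega> \<bullet> \<xi> \<omega> + \<delta> / \<mu> * (6 * L * b + ?x2))"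
      proof (rule mult_left_mono)
        have "\<delta> / \<mu> * (3 / 2 * ?u2 + ?x2) \<le> \<delta> / \<mu> * (6 * L * b + ?x2)"
          using uA'[OF True] \<delta> \<mu> by (intro mult_left_mono) auto
        moreover have "(2 * \<mu> * V (X \<omega>)) / L \<le> ?u2 / L"
          using u2[of \<omega>] L by (intro divide_right_mono) auto
        ultimately show "u \<omega> \<bullet> d \<omega> \<le> - (2 * \<mu> * V (X \<omega>)) / L - y \<omega> \<bullet> \<xi> \<omega> + \<delta> / \<mu> * (6 * L * b + ?x2)"
          using dir(1) by linarith
      qed (use \<alpha> in simp)
      also have "(L + 1 / (4 * cmin)) * \<alpha>\<^sup>2 * (norm (d \<omega>))\<^sup>2 \<le> C * \<alpha>\<^sup>2 * (K * (8 * L * b + 2 * ?x2))"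
        unfolding C_def[symmetric]
      proof (rule mult_left_mono)
        have "K * (2 * ?u2 + 2 * ?x2) \<le> K * (8 * L * b + 2 * ?x2)"
          using uA'[OF True] CK by (intro mult_left_mono) auto
        thus "(norm (d \<omega>))\<^sup>2 \<le> K * (8 * L * b + 2 * ?x2)" using dir(2) by linarith
      qed (use CK in simp)
      finally show ?thesis using True \<open>\<omega> \<in> A\<close> Vb
        by (simp add: H_def R_def y\<xi>_def algebra_simps)
    next
      case False
      show ?thesis
      proof (cases "\<omega> \<in> A")
        case True
        hence "b \<le> V (X \<omega>)" using False by (auto simp: A'_def)
        thus ?thesis using True False R0[of \<omega>] by (simp add: H_def y\<xi>_def min_def)
      next
        case nA: False
        thus ?thesis using False R0[of \<omega>] by (simp add: H_def y\<xi>_def)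
      qed
    qed
  qed
  have i1: "integrable M (\<lambda>\<omega>. indicator A \<omega> * min (V (Y \<omega>)) b)" if [measurable]: "Y \<in> borel_measurable M" for Y
    using V0 b by (intro integrable_const_bound[of _ b]) (auto simp: indicator_def)
  have i2: "integrable M (\<lambda>\<omega>. indicator A \<omega> * (indicator {..<b} (V (X \<omega>)) * V (X \<omega>)))"
    using V0 b by (intro integrable_const_bound[of _ b]) (auto simp: indicator_def)
  have iH: "integrable M H" unfolding H_def
    by (intro Bochner_Integration.integrable_add Bochner_Integration.integrable_diff integrable_mult_right i1[OF XM] i2 iy\<xi> iR)
  have "(\<integral>\<omega>. indicator A \<omega> * min (V (X' \<omega>)) b \<partial>M) \<le> (\<integral>\<omega>. H \<omega> \<partial>M)"
    using i1[OF meas(1)] iH pointwise by (rule integral_mono_AE)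
  also have "(\<integral>\<omega>. H \<omega> \<partial>M) = (\<integral>\<omega>. indicator A \<omega> * min (V (X \<omega>)) b \<partial>M)
      - 2 * \<mu> / L * \<alpha> * (\<integral>\<omega>. indicator A \<omega> * (indicator {..<b} (V (X \<omega>)) * V (X \<omega>)) \<partial>M) - \<alpha> * (\<integral>\<omega>. y\<xi> \<omega> \<partial>M) + (\<integral>\<omega>. R \<omega> \<partial>M)"
    unfolding H_def using i1[OF XM] i2 iy\<xi> iR
    by (subst Bochner_Integration.integral_add Bochner_Integration.integral_diff;
        (intro Bochner_Integration.integrable_diff integrable_mult_right)?; simp?)+
  also have "(\<integral>\<omega>. R \<omega> \<partial>M) \<le> (1 + b) * ((6 * L + c1) / \<mu> * (\<delta> * \<alpha>)
        + (L + 1 / (4 * cmin)) * ((1 + \<Delta>) / \<mu>)\<^sup>2 * (8 * L + 2 * c1) * \<alpha>\<^sup>2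
        + \<zeta> + (1 + 4 * L * cmin) * prob J)"
  proof -
    let ?E = "\<integral>\<omega>. (norm (\<xi> \<omega>))\<^sup>2 \<partial>M"
    have "(\<integral>\<omega>. R \<omega> \<partial>M) = (\<integral>\<omega>. (\<alpha> * (\<delta> / \<mu>) * (6 * L * b) + C * \<alpha>\<^sup>2 * K * (8 * L * b) + \<zeta>)
        + (\<alpha> * (\<delta> / \<mu>) + C * \<alpha>\<^sup>2 * K * 2) * (norm (\<xi> \<omega>))\<^sup>2 + b * (1 + 4 * L * cmin) * indicator J \<omega> \<partial>M)"
      unfolding R_def by (rule Bochner_Integration.integral_cong) (auto simp: algebra_simps)
    also have "\<dots> = (\<alpha> * (\<delta> / \<mu>) * (6 * L * b) + C * \<alpha>\<^sup>2 * K * (8 * L * b) + \<zeta>)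
        + (\<alpha> * (\<delta> / \<mu>) + C * \<alpha>\<^sup>2 * K * 2) * ?E + b * (1 + 4 * L * cmin) * prob J"
    proof -
      have a: "integrable M (\<lambda>\<omega>. (\<alpha> * (\<delta> / \<mu>) + C * \<alpha>\<^sup>2 * K * 2) * (norm (\<xi> \<omega>))\<^sup>2)"
        using i\<xi> by (rule integrable_mult_right)
      have b: "integrable M (\<lambda>\<omega>. b * (1 + 4 * L * cmin) * indicator J \<omega>)"
        by (intro integrable_mult_right) (auto simp: less_top[symmetric])
      show ?thesis
        by (simp only: Bochner_Integration.integral_add[OF Bochner_Integration.integrable_add[OF integrable_const a] b]
            Bochner_Integration.integral_add[OF integrable_const a]) (simp add: prob_space)
    qed
    also have "\<dots> \<le> (\<alpha> * (\<delta> / \<mu>) * (6 * L * b) + C * \<alpha>\<^sup>2 * K * (8 * L * b) + \<zeta>)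
        + (\<alpha> * (\<delta> / \<mu>) + C * \<alpha>\<^sup>2 * K * 2) * c1 + b * (1 + 4 * L * cmin) * prob J"
      using E\<xi> \<alpha> \<delta> \<mu> CK by (intro add_right_mono add_left_mono mult_left_mono) auto
    also have "\<dots> = \<alpha> * (\<delta> / \<mu>) * (6 * L * b + c1) + C * \<alpha>\<^sup>2 * K * (8 * L * b + 2 * c1) + \<zeta>
        + b * ((1 + 4 * L * cmin) * prob J)"
      by (simp add: algebra_simps)
    \<comment> \<open>Coefficients of the form \<open>p * b + q\<close> are enlarged to
      \<open>(1 + b) * (p + q)\<close>, so that one error sequence works for every level.\<close>
    also have "\<dots> \<le> \<alpha> * (\<delta> / \<mu>) * ((1 + b) * (6 * L + c1)) + C * \<alpha>\<^sup>2 * K * ((1 + b) * (8 * L + 2 * c1))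
        + (1 + b) * \<zeta> + (1 + b) * ((1 + 4 * L * cmin) * prob J)"
    proof (intro add_mono)
      have "6 * L * b + c1 \<le> (1 + b) * (6 * L + c1)" "8 * L * b + 2 * c1 \<le> (1 + b) * (8 * L + 2 * c1)"
        using mult_pos_pos[OF b c1] L by (simp_all add: algebra_simps)
      thus "\<alpha> * (\<delta> / \<mu>) * (6 * L * b + c1) \<le> \<alpha> * (\<delta> / \<mu>) * ((1 + b) * (6 * L + c1))"
        "C * \<alpha>\<^sup>2 * K * (8 * L * b + 2 * c1) \<le> C * \<alpha>\<^sup>2 * K * ((1 + b) * (8 * L + 2 * c1))"
        using \<alpha> \<delta> \<mu> CK
        by (auto intro!: mult_left_mono simp del: times_divide_eq_left times_divide_eq_right)
      show "\<zeta> \<le> (1 + b) * \<zeta>" using b \<zeta> by (simp add: algebra_simps)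
      show "b * ((1 + 4 * L * cmin) * prob J) \<le> (1 + b) * ((1 + 4 * L * cmin) * prob J)"
        using L cmin by (intro mult_right_mono mult_nonneg_nonneg) auto
    qed
    also have "\<dots> = (1 + b) * ((6 * L + c1) / \<mu> * (\<delta> * \<alpha>) + C * K * (8 * L + 2 * c1) * \<alpha>\<^sup>2
        + \<zeta> + (1 + 4 * L * cmin) * prob J)"
      by (simp add: algebra_simps add_divide_distrib)
    finally show ?thesis unfolding C_def K_def .
  qed
  finally show ?thesis using y\<xi>0' by simp
qed

section \<open>Almost sure convergence of the iterates to the minimizer\<close>

theorem theorem3p11:
  fixes M :: "'a measure"
    and N Kmax :: nat
    and \<phi>i :: "nat \<Rightarrow> real ^ 'n \<Rightarrow> real"
    and \<phi> :: "real ^ 'n \<Rightarrow> real"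
    and x0 :: "real ^ 'n" and B0 :: "real ^ 'n ^ 'n"
    and \<eta> \<beta> cmin Cmax \<mu> L c1 \<phi>star :: real
    and \<alpha> \<zeta> \<delta> :: "nat \<Rightarrow> real"
    and Ns Ds :: "nat \<Rightarrow> 'a \<Rightarrow> nat set"
    and x g d :: "nat \<Rightarrow> 'a \<Rightarrow> real ^ 'n"
    and B :: "nat \<Rightarrow> 'a \<Rightarrow> real ^ 'n ^ 'n"
    and t :: "nat \<Rightarrow> 'a \<Rightarrow> real"
    and Kf :: "nat \<Rightarrow> 'a \<Rightarrow> nat"
    and ind :: "nat \<Rightarrow> 'a \<Rightarrow> bool"
  assumes prob: "prob_space M"
    \<comment> \<open>problem\<close>
    and N: "N \<ge> 1"
    and C2: "\<And>i. i \<in> {1..N} \<Longrightarrow> twice_continuously_differentiable (\<phi>i i)"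
    and \<phi>: "\<phi> = avg \<phi>i {1..N}"
    \<comment> \<open>parameters of the algorithm\<close>
    and \<eta>: "0 < \<eta>" "\<eta> < 1" and \<beta>: "0 < \<beta>" "\<beta> < 1"
    and \<alpha>_pos: "\<And>k. \<alpha> k > 0" and \<zeta>_pos: "\<And>k. \<zeta> k > 0" and \<delta>_nonneg: "\<And>k. \<delta> k \<ge> 0"
    and c_pos: "cmin > 0" "Cmax > 0"
    \<comment> \<open>the random variables of the run\<close>
    and meas: "\<And>k. x k \<in> borel_measurable M" "\<And>k. g k \<in> borel_measurable M"
      "\<And>k. d k \<in> borel_measurable M" "\<And>k. B k \<in> borel_measurable M"
    \<comment> \<open>initialization\<close>
    and init: "\<And>\<omega>. \<omega> \<in> space M \<Longrightarrow> x 0 \<omega> = x0 \<and> B 0 \<omega> = B0 \<and> Kf 0 \<omega> = 0 \<and> \<not> ind 0 \<omega>"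
    \<comment> \<open>sampling\<close>
    and sample_Ns: "\<And>k. uniform_sample M (before_Ns M N x B Ns g d Ds k) (space M) N (Ns k)"
    and sample_Ds: "\<And>k. uniform_sample M (before_Ds M N x B Ns g d Ds k)
                          {\<omega> \<in> space M. \<not> ind k \<omega>} N (Ds k)"
    \<comment> \<open>search direction\<close>
    and direction: "\<And>k \<omega>. \<omega> \<in> space M \<Longrightarrow>
      norm (B k \<omega> *v d k \<omega> + g k \<omega>) \<le> \<delta> k * norm (g k \<omega>)"
    \<comment> \<open>line-search phase\<close>
    and line_search: "\<And>k \<omega>. \<omega> \<in> space M \<Longrightarrow> \<not> ind k \<omega> \<Longrightarrow>
      (\<exists>j. t k \<omega> = \<beta> ^ j \<and>
           nonmonotone_armijo (avg \<phi>i (Ns k \<omega>)) \<eta> (\<zeta> k) (x k \<omega>) (g k \<omega>) (d k \<omega>) (\<beta> ^ j) \<and>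
           (\<forall>i<j. \<not> nonmonotone_armijo (avg \<phi>i (Ns k \<omega>)) \<eta> (\<zeta> k) (x k \<omega>) (g k \<omega>) (d k \<omega>) (\<beta> ^ i)))"
    and update_ls: "\<And>k \<omega>. \<omega> \<in> space M \<Longrightarrow> \<not> ind k \<omega> \<Longrightarrow>
      (let xbar = x k \<omega> + t k \<omega> *\<^sub>R d k \<omega> in
       if sample_decrease \<phi>i (Ds k \<omega>) cmin Cmax (\<zeta> k) (x k \<omega>) xbar
       then x (Suc k) \<omega> = xbar \<and> Kf (Suc k) \<omega> = Kf k \<omega> \<and> ind (Suc k) \<omega> = ind k \<omega>
       else x (Suc k) \<omega> = x k \<omega> \<and> Kf (Suc k) \<omega> = Kf k \<omega> + 1 \<and>
            ind (Suc k) \<omega> = (Kf (Suc k) \<omega> > Kmax))"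
    \<comment> \<open>predefined-step phase\<close>
    and update_sa: "\<And>k \<omega>. \<omega> \<in> space M \<Longrightarrow> ind k \<omega> \<Longrightarrow>
      t k \<omega> = \<alpha> k \<and> x (Suc k) \<omega> = x k \<omega> + \<alpha> k *\<^sub>R d k \<omega> \<and>
      Kf (Suc k) \<omega> = Kf k \<omega> \<and> ind (Suc k) \<omega> = ind k \<omega>"
    \<comment> \<open>conditional independence of \<open>g k\<close> and \<open>B k\<close> given the iterates up to \<open>x k\<close>\<close>
    and cond_indep: "\<And>k. cond_indep_var M (iterates_algebra M x k) (g k) (B k)"
    and cond_prod: "\<And>k. AE \<omega> in M.
      vec_cond_exp M (iterates_algebra M x k) (\<lambda>\<omega>'. B k \<omega>' *v g k \<omega>') \<omega>
      = B k \<omega> *v vec_cond_exp M (iterates_algebra M x k) (g k) \<omega>"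
    \<comment> \<open>(A1)\<close>
    and A1_bounded: "\<And>y. \<phi>star \<le> \<phi> y"
    and A1_lipschitz: "\<And>i. i \<in> {1..N} \<Longrightarrow> lipschitz_on L UNIV (gradient (\<phi>i i))"
    \<comment> \<open>(A2)\<close>
    and A2_const: "\<mu> > 0" "L > 0"
    and A2: "\<And>k. AE \<omega> in M. transpose (B k \<omega>) = B k \<omega> \<and>
      loewner_le (mat \<mu>) (B k \<omega>) \<and> loewner_le (B k \<omega>) (mat L)"
    \<comment> \<open>(A3)\<close>
    and A3_const: "c1 > 0"
    and A3_mean: "\<And>k. AE \<omega> in M.
      vec_cond_exp M (iterates_algebra M x k) (g k) \<omega> = gradient \<phi> (x k \<omega>)"
    and A3_var: "\<And>k. AE \<omega> in M.
      nn_cond_exp M (iterates_algebra M x k)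
        (\<lambda>\<omega>'. ennreal ((norm (gradient \<phi> (x k \<omega>') - g k \<omega>'))\<^sup>2)) \<omega> \<le> ennreal c1"
    \<comment> \<open>(A4)\<close>
    and A4: "summable \<zeta>" "filterlim (\<lambda>n. \<Sum>k<n. \<alpha> k) at_top sequentially"
      "summable (\<lambda>k. (\<alpha> k)\<^sup>2)" "\<delta> \<longlonglongrightarrow> 0" "summable (\<lambda>k. \<delta> k * \<alpha> k)"
    \<comment> \<open>strong convexity\<close>
    and strong: "strongly_convex \<mu> \<phi>"
  shows "\<exists>xstar. (\<forall>z. is_arg_min \<phi> (\<lambda>_. True) z \<longleftrightarrow> z = xstar) \<and>
           (AE \<omega> in M. (\<lambda>k. x k \<omega>) \<longlonglongrightarrow> xstar)"
proof -
  interpret prob_space M by (rule prob)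
  define G where "G = avg_grad \<phi>i {1..N}"
  have gi: "GDERIV (\<phi>i i) y :> gradient (\<phi>i i) y" if "i \<in> {1..N}" for i y
    using C2[OF that] unfolding twice_continuously_differentiable_def
    by (intro differentiable_imp_GDERIV_gradient) auto
  have G: "GDERIV \<phi> y :> G y" for y
    unfolding \<phi> G_def by (rule GDERIV_avg) (rule gi)
  have grad: "gradient \<phi> y = G y" for y using G by (rule gradient_eqI)
  have lip: "lipschitz_on L UNIV G"
    unfolding G_def using N by (intro lipschitz_on_avg_grad A1_lipschitz) auto
  \<comment> \<open>The minimizer comes with quadratic growth, which gives uniqueness and, at the
    end, turns vanishing suboptimality into convergence of the iterates.\<close>
  obtain z where z: "\<And>y. \<phi> z + \<mu> / 2 * (norm (y - z))\<^sup>2 \<le> \<phi> y"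
    using strongly_convex_minimizer[OF strong G A2_const(1)] by blast
  have zmin: "\<phi> z \<le> \<phi> y" for y
    using z[of y] A2_const(1) by (smt (verit) mult_nonneg_nonneg zero_le_power2 divide_nonneg_pos)
  have argmin: "is_arg_min \<phi> (\<lambda>_. True) w \<longleftrightarrow> w = z" for w
  proof
    assume "is_arg_min \<phi> (\<lambda>_. True) w"
    hence "\<phi> w \<le> \<phi> z" by (auto simp: is_arg_min_def not_less)
    hence "\<mu> / 2 * (norm (w - z))\<^sup>2 \<le> 0" using z[of w] by linarith
    thus "w = z" using A2_const(1) by (simp add: mult_le_0_iff)
  qed (use zmin in \<open>auto simp: is_arg_min_def not_less\<close>)

  define F where "F = iterates_algebra M x"
  have sub: "subalgebra M (F k)" for k
    unfolding F_def iterates_algebra_def using meas(1)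
    by (intro subalgebra_sigma UN_least preimages_subset_sets)
  have adapted: "x j \<in> borel_measurable (F k)" if "j \<le> k" for j k
    unfolding F_def iterates_algebra_def
  proof (rule measurable_sigma_preimages[OF meas(1)])
    show "(\<Union>j\<le>k. preimages M borel (x j)) \<subseteq> Pow (space M)" by (auto simp: preimages_def)
  qed (use that in auto)

  \<comment> \<open>The point actually reached is tested, so a rejection belongs to
    \<open>J k\<close> whenever staying at \<open>x k\<close> violates the full decrease.\<close>
  define J where "J = (\<lambda>k. {\<omega> \<in> space M. \<not> ind k \<omega> \<and>
      \<not> sample_decrease \<phi>i {1..N} cmin Cmax (\<zeta> k) (x k \<omega>) (x (Suc k) \<omega>)})"
  have cont: "continuous_on UNIV (\<phi>i i)" "continuous_on UNIV (gradient (\<phi>i i))" if "i \<in> {1..N}" for i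
  proof -
    show "continuous_on UNIV (\<phi>i i)" using gi[OF that] unfolding gderiv_def
      by (meson continuous_at_imp_continuous_on has_derivative_continuous)
    show "continuous_on UNIV (gradient (\<phi>i i))" using A1_lipschitz[OF that]
      by (rule lipschitz_on_continuous_on)
  qed
  have NsM: "Ns k \<in> measurable M (count_space (Pow {1..N}))" for k
    using sample_Ns[of k] by (simp add: uniform_sample_def)
  have init': "Kf 0 \<omega> = 0 \<and> \<not> ind 0 \<omega>" if "\<omega> \<in> space M" for \<omega>
    using init[OF that] by simp
  have sa': "Kf (Suc k) \<omega> = Kf k \<omega> \<and> ind (Suc k) \<omega> = ind k \<omega>" if "\<omega> \<in> space M" "ind k \<omega>" for k \<omega>
    using update_sa[OF that] by simp
  note failures = line_search_failures_summable[where x = x and g = g and d = d and B = B and Ns = Ns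
      and Ds = Ds and t = t and Kf = Kf and ind = ind and Kmax = Kmax and \<beta> = \<beta> and \<eta> = \<eta>]
  have J: "J k \<in> events" for k
    unfolding J_def
    by (rule failures(1)) (fact cont c_pos meas init' NsM sample_Ds line_search update_ls sa')+
  have J_sum: "summable (\<lambda>k. prob (J k))"
    unfolding J_def
    by (rule failures(2)) (fact cont c_pos meas init' NsM sample_Ds line_search update_ls sa')+

  \<comment> \<open>Convergence of \<delta> bounds all of its terms, early ones included; the
    second-order constant must be uniform in \<open>k\<close>.\<close>
  obtain \<Delta> where \<Delta>: "\<And>k. \<delta> k \<le> \<Delta>"
  proof -
    have "Bseq \<delta>" using A4(4) by (intro convergent_imp_Bseq convergentI)
    then obtain K where "\<And>k. norm (\<delta> k) \<le> K" by (auto simp: Bseq_def)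
    thus ?thesis using that by (metis abs_le_D1 real_norm_def)
  qed
  \<comment> \<open>The first three terms are summable by the conditions on step lengths,
    inexactness and slack, the last one by the summability of the first-phase failures.\<close>
  define e where "e = (\<lambda>k. (6 * L + c1) / \<mu> * (\<delta> k * \<alpha> k)
        + (L + 1 / (4 * cmin)) * ((1 + \<Delta>) / \<mu>)\<^sup>2 * (8 * L + 2 * c1) * (\<alpha> k)\<^sup>2
        + Cmax * \<zeta> k + (1 + 4 * L * cmin) * prob (J k))"
  define V where "V = (\<lambda>k \<omega>. \<phi> (x k \<omega>) - \<phi> z)"
  have "AE \<omega> in M. (\<lambda>k. V k \<omega>) \<longlonglongrightarrow> 0"
  proof (rule almost_supermartingale_AE_tendsto_zero)
    show "subalgebra M (F k)" for k by (rule sub)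
    have "continuous_on UNIV \<phi>"
      using G unfolding gderiv_def by (meson continuous_at_imp_continuous_on has_derivative_continuous)
    hence "(\<lambda>y. \<phi> y - \<phi> z) \<in> borel_measurable borel"
      by (intro borel_measurable_continuous_onI continuous_intros)
    thus "V j \<in> borel_measurable (F k)" if "j \<le> k" for j k
      unfolding V_def using adapted[OF that] by (rule measurable_compose[rotated])
    show "0 \<le> V k \<omega>" for k \<omega> using zmin by (simp add: V_def)
    show "0 \<le> e k" for k
      unfolding e_def using A2_const A3_const \<delta>_nonneg[of k] \<alpha>_pos[of k] \<zeta>_pos[of k] c_pos
      by (intro add_nonneg_nonneg mult_nonneg_nonneg divide_nonneg_pos) auto
    show "summable e"
      unfolding e_def by (intro summable_add summable_mult A4 J_sum)
    show "0 \<le> 2 * \<mu> / L * \<alpha> k" for k using A2_const \<alpha>_pos[of k] by simp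
    show "filterlim (\<lambda>n. \<Sum>k<n. 2 * \<mu> / L * \<alpha> k) at_top sequentially"
      unfolding sum_distrib_left[symmetric] using A2_const A4(2)
      by (intro filterlim_tendsto_pos_mult_at_top[OF tendsto_const]) auto
    fix k b A assume b: "(b::real) > 0" and A: "A \<in> sets (F k)"
    show "(\<integral>\<omega>. indicator A \<omega> * min (V (Suc k) \<omega>) b \<partial>M)
        \<le> (\<integral>\<omega>. indicator A \<omega> * min (V k \<omega>) b \<partial>M)
          - 2 * \<mu> / L * \<alpha> k * (\<integral>\<omega>. indicator A \<omega> * (indicator {..<b} (V k \<omega>) * V k \<omega>) \<partial>M) + (1 + b) * e k"
      unfolding V_def e_def
    proof (rule stochastic_newton_step[OF G A2_const(2) lip A2_const(1) strong zmin sub adapted[OF order.refl]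
          meas(1,2,4)])
      show "cond_indep_var M (F k) (g k) (B k)" unfolding F_def by (rule cond_indep)
      show "AE \<omega> in M. vec_cond_exp M (F k) (g k) \<omega> = G (x k \<omega>)"
        using A3_mean[of k] unfolding F_def grad .
      show "AE \<omega> in M. nn_cond_exp M (F k) (\<lambda>\<omega>. ennreal ((norm (G (x k \<omega>) - g k \<omega>))\<^sup>2)) \<omega> \<le> ennreal c1"
        using A3_var[of k] unfolding F_def grad .
      show "0 \<le> Cmax * \<zeta> k" using c_pos \<zeta>_pos[of k] by simp
      fix \<omega> assume \<omega>: "\<omega> \<in> space M"
      \<comment> \<open>In the second phase the first alternative is the update rule; in the first
        phase, failure of the decrease is membership in \<open>J k\<close>.\<close>
      show "x (Suc k) \<omega> = x k \<omega> + \<alpha> k *\<^sub>R d k \<omega> \<or>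
          \<phi> (x (Suc k) \<omega>) \<le> \<phi> (x k \<omega>) - cmin * (norm (G (x k \<omega>)))\<^sup>2 + Cmax * \<zeta> k \<or> \<omega> \<in> J k"
        using update_sa[OF \<omega>, of k] \<omega> by (auto simp: J_def sample_decrease_def \<phi> G_def)
    qed (use A3_const A2 direction \<delta>_nonneg \<Delta> \<alpha>_pos c_pos J A b in auto)
  qed
  hence "AE \<omega> in M. (\<lambda>k. x k \<omega>) \<longlonglongrightarrow> z"
  proof eventually_elim
    case (elim \<omega>)
    have "(\<lambda>k. (norm (x k \<omega> - z))\<^sup>2) \<longlonglongrightarrow> 0"
    proof (rule tendsto_sandwich[of "\<lambda>_. 0" _ _ "\<lambda>k. 2 / \<mu> * V k \<omega>"])
      have "(norm (x k \<omega> - z))\<^sup>2 \<le> 2 / \<mu> * V k \<omega>" for k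
        using z[of "x k \<omega>"] A2_const(1) by (simp add: V_def field_simps)
      thus "eventually (\<lambda>k. (norm (x k \<omega> - z))\<^sup>2 \<le> 2 / \<mu> * V k \<omega>) sequentially" by simp
      show "(\<lambda>k. 2 / \<mu> * V k \<omega>) \<longlonglongrightarrow> 0" using tendsto_mult_left[OF elim, of "2 / \<mu>"] by simp
    qed auto
    from tendsto_real_sqrt[OF this] have "(\<lambda>k. norm (x k \<omega> - z)) \<longlonglongrightarrow> 0" by simp
    thus ?case by (metis LIM_zero_cancel tendsto_norm_zero_iff)
  qed
  thus ?thesis using argmin by blast
qed

end
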